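(* Let $C_1$ and $C_2$ be clones on $\{0,1\}$ such that $C_1 \subseteq K_1$ and $C_2 \subseteq K_2$ for some pair \[ \begin{split} (K_1, K_2) \in \{ & (\Omega(1), \Omega(1)), (\Omega(1), \Lambda), (\Omega(1), V), (I^*, U^\infty), (I^*, W^\infty), \\ & (I_0, U^\infty), (I_1, U^\infty), (I_0, W^\infty), (I_1, W^\infty), (L, \Omega(1)), \\ & (\Lambda, \Lambda), (\Lambda, V), (V, \Lambda), (V, V), (\Lambda, \Omega(1)), (V, \Omega(1)) \}. \end{split} \] Then there are uncountably many $(C_1,C_2)$-clonoids of Boolean functions.
   Context: A Boolean function is a map $f \colon \{0,1\}^n \to \{0,1\}$ for some integer $n \geq 1$ (its arity). If $f$ is $n$-ary and $g_1,\dots,g_n$ are $m$-ary, then $f(g_1,\dots,g_n)$ is the $m$-ary function $\mathbf{a} \mapsto f(g_1(\mathbf{a}),\dots,g_n(\mathbf{a}))$. For sets $F, G$ of Boolean functions, $FG$ is the set of all composites $f(g_1,\dots,g_n)$ with $f \in F$ of some arity $n$ and $g_1,\dots,g_n \in G$ all of a common arity. A clone on $\{0,1\}$ is a set $C$ of Boolean functions containing all projections $\mathrm{pr}^{(n)}_i(a_1,\dots,a_n)=a_i$ and satisfying $CC \subseteq C$. For clones $C_1,C_2$ on $\{0,1\}$, a (possibly empty) set $K$ of Boolean functions is a $(C_1,C_2)$-clonoid if $KC_1 \subseteq K$ and $C_2K \subseteq K$. Notation for clones on $\{0,1\}$ (all functions of all arities): $\Omega(1)$ is the set of all projections, negated projections,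 and constant functions; $I^*$ the set of all projections and negated projections; $I_0$ (resp. $I_1$) the set of all projections and constant functions with value $0$ (resp. $1$); $L$ is the clone generated by addition modulo 2 and the constant $1$ (linear functions); $\Lambda$ is the clone generated by $\wedge$ and the constants $0,1$; $V$ is the clone generated by $\vee$ and the constants $0,1$. $U^\infty$ is the set of all Boolean functions $f$ such that $\bigwedge T \neq \mathbf{0}=(0,\dots,0)$ for every $T \subseteq f^{-1}(1)$; $W^\infty$ is the set of all Boolean functions $f$ such that $\bigvee F \neq \mathbf{1}=(1,\dots,1)$ for every $F \subseteq f^{-1}(0)$ (meets and joins componentwise, with $\bigwedge\emptyset=\mathbf{1}$, $\bigvee\emptyset=\mathbf{0}$). *)

theory Defs
  imports Main "HOL-Library.FuncSet" "HOL-Library.Countable_Set"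
begin

text \<open>
  The elements of \<open>{0,1}\<^sup>n\<close> are the Boolean lists of length \<open>n\<close>, with \<open>False\<close> for 0 and \<open>True\<close>
  for 1. Coordinates are numbered from 0.
\<close>

definition cube :: "nat \<Rightarrow> bool list set" where
  "cube n = {a. length a = n}"

text \<open>
  An \<open>n\<close>-ary Boolean function is a pair of its arity and a map that is \<open>undefined\<close> outside
  \<open>cube n\<close>. Hence equality of pairs in \<open>boolfuns\<close> is equality of Boolean functions, and counting
  subsets of \<open>boolfuns\<close> is counting sets of Boolean functions.
\<close>

type_synonym boolfun = "nat \<times> (bool list \<Rightarrow> bool)"

abbreviation arity :: "boolfun \<Rightarrow> nat" where
  "arity \<equiv> fst"

abbreviation app :: "boolfun \<Rightarrow> bool list \<Rightarrow> bool" where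
  "app \<equiv> snd"

definition boolfuns :: "boolfun set" where
  "boolfuns = {f. arity f \<ge> 1 \<and> app f \<in> extensional (cube (arity f))}"

definition mk_fun :: "nat \<Rightarrow> (bool list \<Rightarrow> bool) \<Rightarrow> boolfun" where
  "mk_fun n f = (n, restrict f (cube n))"

text \<open>\<open>compose m f [g\<^sub>1, \<dots>, g\<^sub>n]\<close> is \<open>f(g\<^sub>1, \<dots>, g\<^sub>n)\<close>, where all \<open>g\<^sub>i\<close> are \<open>m\<close>-ary.\<close>

definition compose :: "nat \<Rightarrow> boolfun \<Rightarrow> boolfun list \<Rightarrow> boolfun" where
  "compose m f gs = mk_fun m (\<lambda>a. app f (map (\<lambda>g. app g a) gs))"

definition set_compose :: "boolfun set \<Rightarrow> boolfun set \<Rightarrow> boolfun set" where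
  "set_compose F G =
     {compose m f gs | m f gs.
        f \<in> F \<and> length gs = arity f \<and> set gs \<subseteq> G \<and> (\<forall>g\<in>set gs. arity g = m)}"

definition proj :: "nat \<Rightarrow> nat \<Rightarrow> boolfun" where
  "proj n i = mk_fun n (\<lambda>a. a ! i)"

definition neg_proj :: "nat \<Rightarrow> nat \<Rightarrow> boolfun" where
  "neg_proj n i = mk_fun n (\<lambda>a. \<not> a ! i)"

definition const :: "nat \<Rightarrow> bool \<Rightarrow> boolfun" where
  "const n c = mk_fun n (\<lambda>a. c)"

definition projections :: "boolfun set" where
  "projections = {proj n i | n i. i < n}"

definition neg_projections :: "boolfun set" where
  "neg_projections = {neg_proj n i | n i. i < n}"

definition constants :: "bool \<Rightarrow> boolfun set" where
  "constants c = {const n c | n. n \<ge> 1}"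

definition clone :: "boolfun set \<Rightarrow> bool" where
  "clone C \<longleftrightarrow> C \<subseteq> boolfuns \<and> projections \<subseteq> C \<and> set_compose C C \<subseteq> C"

definition clonoid :: "boolfun set \<Rightarrow> boolfun set \<Rightarrow> boolfun set \<Rightarrow> bool" where
  "clonoid C1 C2 K \<longleftrightarrow>
     K \<subseteq> boolfuns \<and> set_compose K C1 \<subseteq> K \<and> set_compose C2 K \<subseteq> K"

definition clone_generated :: "boolfun set \<Rightarrow> boolfun set" where
  "clone_generated G = \<Inter>{C. clone C \<and> G \<subseteq> C}"

definition and_fun :: boolfun where
  "and_fun = mk_fun 2 (\<lambda>a. a ! 0 \<and> a ! 1)"

definition or_fun :: boolfun where
  "or_fun = mk_fun 2 (\<lambda>a. a ! 0 \<or> a ! 1)"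

definition xor_fun :: boolfun where
  "xor_fun = mk_fun 2 (\<lambda>a. a ! 0 \<noteq> a ! 1)"

definition Omega_1 :: "boolfun set" where
  "Omega_1 = projections \<union> neg_projections \<union> constants False \<union> constants True"

definition I_star :: "boolfun set" where
  "I_star = projections \<union> neg_projections"

definition I_0 :: "boolfun set" where
  "I_0 = projections \<union> constants False"

definition I_1 :: "boolfun set" where
  "I_1 = projections \<union> constants True"

definition L_clone :: "boolfun set" where
  "L_clone = clone_generated ({xor_fun} \<union> constants True)"

definition Lambda_clone :: "boolfun set" where
  "Lambda_clone = clone_generated ({and_fun} \<union> constants False \<union> constants True)"

definition V_clone :: "boolfun set" where
  "V_clone = clone_generated ({or_fun} \<union> constants False \<union> constants True)"

text \<open>Componentwise meet and join of a subset of \<open>cube n\<close>.\<close>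

definition meet :: "nat \<Rightarrow> bool list set \<Rightarrow> bool list" where
  "meet n T = map (\<lambda>i. \<forall>a\<in>T. a ! i) [0..<n]"

definition join :: "nat \<Rightarrow> bool list set \<Rightarrow> bool list" where
  "join n F = map (\<lambda>i. \<exists>a\<in>F. a ! i) [0..<n]"

definition U_inf :: "boolfun set" where
  "U_inf = {f \<in> boolfuns.
     \<forall>T \<subseteq> {a \<in> cube (arity f). app f a}. meet (arity f) T \<noteq> replicate (arity f) False}"

definition W_inf :: "boolfun set" where
  "W_inf = {f \<in> boolfuns.
     \<forall>F \<subseteq> {a \<in> cube (arity f). \<not> app f a}. join (arity f) F \<noteq> replicate (arity f) True}"

end

theory Submission
  imports Defs
begin

text \<open>
  If \<open>R\<close> is invariant under \<open>C1\<close> and \<open>S\<close> under \<open>C2\<close>, then the functions mapping \<open>R\<close> into \<open>S\<close> form a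
  \<open>(C1, C2)\<close>-clonoid. For each pair we find functions \<open>f\<^sub>n\<close> and pairs \<open>(R\<^sub>n, S\<^sub>n)\<close> such that \<open>f\<^sub>m\<close> maps
  \<open>R\<^sub>n\<close> into \<open>S\<^sub>n\<close> iff \<open>m \<noteq> n\<close>. Intersections of the resulting clonoids are then indexed injectively
  by the sets of natural numbers.

  Up to duality two families suffice: \<open>f\<^sub>n\<close> accepts the tuples of weight 1 or \<open>n\<close> (the case of
  essentially unary or linear source clones), or of weight 1 or \<open>n - 1\<close> (semilattice source clones),
  with \<open>n \<ge> 5\<close> odd. The elements of \<open>R\<^sub>n\<close> are the \<open>n\<close>-ary functions available for substitution, and
  \<open>S\<^sub>n\<close> is a set of functions avoiding \<open>f\<^sub>n\<close> that is closed under \<open>C2\<close>.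
\<close>

section \<open>Clonoids defined by pairs of relations\<close>

text \<open>Relations are sets of maps \<open>'i \<Rightarrow> bool\<close>, so their arity may be infinite.\<close>

definition preserves :: "('i \<Rightarrow> bool) set \<Rightarrow> ('i \<Rightarrow> bool) set \<Rightarrow> boolfun \<Rightarrow> bool" where
  "preserves R S f \<longleftrightarrow>
     (\<forall>rs. length rs = arity f \<and> set rs \<subseteq> R \<longrightarrow> (\<lambda>i. app f (map (\<lambda>r. r i) rs)) \<in> S)"

lemma preservesD:
  "preserves R S f \<Longrightarrow> length rs = arity f \<Longrightarrow> set rs \<subseteq> R \<Longrightarrow> (\<lambda>i. app f (map (\<lambda>r. r i) rs)) \<in> S"
  by (auto simp: preserves_def)

lemma preserves_mk_fun:
  "preserves R S (mk_fun n h) \<longleftrightarrow>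
     (\<forall>rs. length rs = n \<and> set rs \<subseteq> R \<longrightarrow> (\<lambda>i. h (map (\<lambda>r. r i) rs)) \<in> S)"
  by (auto simp: preserves_def mk_fun_def cube_def)

lemma mk_fun_in_boolfuns: "1 \<le> n \<Longrightarrow> mk_fun n h \<in> boolfuns"
  by (auto simp: boolfuns_def mk_fun_def)

lemma preserves_compose:
  assumes f: "preserves R S f" and gs: "\<And>g. g \<in> set gs \<Longrightarrow> preserves Q R g \<and> arity g = m"
    and len: "length gs = arity f"
  shows "preserves Q S (compose m f gs)"
  unfolding compose_def preserves_mk_fun
proof (intro allI impI)
  fix rs :: "('a \<Rightarrow> bool) list"
  assume rs: "length rs = m \<and> set rs \<subseteq> Q"
  let ?ss = "map (\<lambda>g i. app g (map (\<lambda>r. r i) rs)) gs"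
  have "set ?ss \<subseteq> R"
    using gs rs by (auto intro!: preservesD)
  then show "(\<lambda>i. app f (map (\<lambda>g. app g (map (\<lambda>r. r i) rs)) gs)) \<in> S"
    using preservesD[OF f, of ?ss] len by (simp add: comp_def)
qed

lemma compose_in_boolfuns:
  assumes "f \<in> boolfuns" "set gs \<subseteq> boolfuns" "length gs = arity f" "\<forall>g\<in>set gs. arity g = m"
  shows "compose m f gs \<in> boolfuns"
proof -
  have "gs \<noteq> []"
    using assms by (auto simp: boolfuns_def)
  then obtain g where "g \<in> set gs"
    using list.set_sel(1) by blast
  then have "1 \<le> m"
    using assms by (auto simp: boolfuns_def)
  then show ?thesis
    by (simp add: compose_def mk_fun_in_boolfuns)
qed

lemma set_compose_boolfuns: "set_compose boolfuns boolfuns \<subseteq> boolfuns"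
proof
  fix h assume "h \<in> set_compose boolfuns boolfuns"
  then obtain m f gs where "h = compose m f gs" "f \<in> boolfuns" "length gs = arity f"
    "set gs \<subseteq> boolfuns" "\<forall>g\<in>set gs. arity g = m"
    unfolding set_compose_def by blast
  then show "h \<in> boolfuns"
    using compose_in_boolfuns by blast
qed

definition Pol :: "('i \<Rightarrow> bool) set \<Rightarrow> ('i \<Rightarrow> bool) set \<Rightarrow> boolfun set" where
  "Pol R S = {f \<in> boolfuns. preserves R S f}"

text \<open>Inner functions carry \<open>Q\<close> into \<open>R\<close> and outer ones carry
  \<open>R\<close> into \<open>S\<close>. Taking \<open>Q = R\<close>, \<open>R = S\<close>, or all
  three equal gives the two closure conditions of a clonoid and closure of \<open>Pol R R\<close>
  under composition.\<close>

lemma set_compose_Pol: "set_compose (Pol R S) (Pol Q R) \<subseteq> Pol Q S"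
  by (auto simp: set_compose_def Pol_def subset_iff intro!: compose_in_boolfuns preserves_compose)

lemma set_compose_mono: "F \<subseteq> F' \<Longrightarrow> G \<subseteq> G' \<Longrightarrow> set_compose F G \<subseteq> set_compose F' G'"
  unfolding set_compose_def by blast

lemma clonoid_Pol:
  assumes "C1 \<subseteq> Pol R R" "C2 \<subseteq> Pol S S"
  shows "clonoid C1 C2 (Pol R S)"
  unfolding clonoid_def
proof (intro conjI)
  show "Pol R S \<subseteq> boolfuns"
    by (auto simp: Pol_def)
  show "set_compose (Pol R S) C1 \<subseteq> Pol R S"
    using set_compose_mono[OF order_refl assms(1)] set_compose_Pol by blast
  show "set_compose C2 (Pol R S) \<subseteq> Pol R S"
    using set_compose_mono[OF assms(2) order_refl] set_compose_Pol by blast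
qed

lemma clonoid_Inter:
  assumes "\<K> \<noteq> {}" "\<And>K. K \<in> \<K> \<Longrightarrow> clonoid C1 C2 K"
  shows "clonoid C1 C2 (\<Inter>\<K>)"
  unfolding clonoid_def
proof (intro conjI)
  show "\<Inter>\<K> \<subseteq> boolfuns"
  proof -
    obtain K where "K \<in> \<K>"
      using assms(1) by blast
    then show ?thesis
      using assms(2)[of K] by (auto simp: clonoid_def)
  qed
  show "set_compose (\<Inter>\<K>) C1 \<subseteq> \<Inter>\<K>"
  proof (rule Inter_greatest)
    fix K assume "K \<in> \<K>"
    then show "set_compose (\<Inter>\<K>) C1 \<subseteq> K"
      using assms(2)[of K] set_compose_mono[of "\<Inter>\<K>" K C1 C1] by (auto simp: clonoid_def)
  qed
  show "set_compose C2 (\<Inter>\<K>) \<subseteq> \<Inter>\<K>"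
  proof (rule Inter_greatest)
    fix K assume "K \<in> \<K>"
    then show "set_compose C2 (\<Inter>\<K>) \<subseteq> K"
      using assms(2)[of K] set_compose_mono[of C2 C2 "\<Inter>\<K>" K] by (auto simp: clonoid_def)
  qed
qed

text \<open>The functions \<open>f n\<close> are independent: \<open>f n\<close> is missing from the
  clonoid indexed by \<open>A\<close> exactly when \<open>n\<close> is in \<open>A\<close>. Distinct
  index sets thus give distinct clonoids, and Cantor's theorem applies.\<close>

lemma uncountable_clonoids:
  fixes f :: "nat \<Rightarrow> boolfun" and R S :: "nat \<Rightarrow> ('i \<Rightarrow> bool) set"
  assumes C1: "\<And>n. C1 \<subseteq> Pol (R n) (R n)" and C2: "\<And>n. C2 \<subseteq> Pol (S n) (S n)"
    and f: "\<And>m n. f m \<in> Pol (R n) (S n) \<longleftrightarrow> m \<noteq> n"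
  shows "uncountable {K. clonoid C1 C2 K}"
proof
  assume *: "countable {K. clonoid C1 C2 K}"
  \<comment> \<open>Inserting \<open>boolfuns\<close> keeps the intersected family nonempty for
    \<open>A = {}\<close>, where the intersection would otherwise contain pairs that are not Boolean
    functions.\<close>
  define \<Phi> where "\<Phi> A = \<Inter>(insert boolfuns ((\<lambda>n. Pol (R n) (S n)) ` A))" for A :: "nat set"
  have fb: "f m \<in> boolfuns" for m
    using f[of m "Suc m"] by (simp add: Pol_def)
  have "C1 \<subseteq> boolfuns" "C2 \<subseteq> boolfuns"
    using C1[of 0] C2[of 0] by (auto simp: Pol_def)
  then have "clonoid C1 C2 boolfuns"
    using order_trans[OF set_compose_mono set_compose_boolfuns] by (simp add: clonoid_def)
  then have "clonoid C1 C2 (\<Phi> A)" for A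
    unfolding \<Phi>_def by (rule_tac clonoid_Inter) (auto intro: clonoid_Pol[OF C1 C2])
  then have "countable (range \<Phi>)"
    by (intro countable_subset[OF _ *]) auto
  moreover have "inj \<Phi>"
  proof
    fix A B assume "\<Phi> A = \<Phi> B"
    moreover have "n \<in> A \<longleftrightarrow> f n \<notin> \<Phi> A" for n A
      using f fb by (auto simp: \<Phi>_def)
    ultimately show "A = B"
      by blast
  qed
  ultimately have "countable (UNIV :: nat set set)"
    by (simp add: countable_image_inj_eq)
  \<comment> \<open>Countability would make \<open>from_nat_into\<close> a surjection from the
    numbers onto their sets.\<close>
  then have "range (from_nat_into (UNIV :: nat set set)) = UNIV"
    by (intro range_from_nat_into UNIV_not_empty)
  then show False
    using Cantors_theorem[of "UNIV :: nat set"] by auto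
qed

section \<open>Invariant relations of the clones\<close>

lemma clone_Pol: "clone (Pol R R)"
proof -
  have "projections \<subseteq> Pol R R"
    by (fastforce simp: projections_def Pol_def proj_def preserves_mk_fun intro!: mk_fun_in_boolfuns)
  then show ?thesis
    by (simp add: clone_def set_compose_Pol) (auto simp: Pol_def)
qed

text \<open>\<open>Pol R R\<close> is itself one of the clones being intersected, so invariance need
  only be checked on generators.\<close>

lemma clone_generated_subset_Pol: "G \<subseteq> Pol R R \<Longrightarrow> clone_generated G \<subseteq> Pol R R"
  unfolding clone_generated_def using clone_Pol by blast

lemma projections_subset_Pol: "projections \<subseteq> Pol R R"
  using clone_Pol[of R] by (simp add: clone_def)

lemma neg_projections_subset_Pol:
  assumes "\<And>r. r \<in> R \<Longrightarrow> (\<lambda>i. \<not> r i) \<in> R"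
  shows "neg_projections \<subseteq> Pol R R"
proof -
  have "(\<lambda>i. \<not> map (\<lambda>r. r i) rs ! k) \<in> R" if "k < length rs" "set rs \<subseteq> R" for rs k
    using that assms[of "rs ! k"] by (auto simp: subset_iff)
  then show ?thesis
    by (auto simp: neg_projections_def Pol_def neg_proj_def preserves_mk_fun
        intro!: mk_fun_in_boolfuns)
qed

lemma constants_subset_Pol:
  assumes "(\<lambda>i. c) \<in> R"
  shows "constants c \<subseteq> Pol R R"
  using assms
  by (auto simp: constants_def Pol_def const_def preserves_mk_fun intro!: mk_fun_in_boolfuns)

lemma binary_in_Pol:
  assumes "\<And>r s. r \<in> R \<Longrightarrow> s \<in> R \<Longrightarrow> (\<lambda>i. h [r i, s i]) \<in> R"
  shows "mk_fun 2 h \<in> Pol R R"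
  using assms
  by (auto simp: Pol_def preserves_mk_fun numeral_2_eq_2 length_Suc_conv intro!: mk_fun_in_boolfuns)

lemma Omega_1_subset_Pol:
  assumes "\<And>r. r \<in> R \<Longrightarrow> (\<lambda>i. \<not> r i) \<in> R" "\<And>c. (\<lambda>i. c) \<in> R"
  shows "Omega_1 \<subseteq> Pol R R"
  using assms by (simp add: Omega_1_def projections_subset_Pol neg_projections_subset_Pol constants_subset_Pol)

lemma I_star_subset_Pol:
  assumes "\<And>r. r \<in> R \<Longrightarrow> (\<lambda>i. \<not> r i) \<in> R"
  shows "I_star \<subseteq> Pol R R"
  using assms by (simp add: I_star_def projections_subset_Pol neg_projections_subset_Pol)

lemma I_0_subset_Pol: "(\<lambda>i. False) \<in> R \<Longrightarrow> I_0 \<subseteq> Pol R R"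
  by (simp add: I_0_def projections_subset_Pol constants_subset_Pol)

lemma I_1_subset_Pol: "(\<lambda>i. True) \<in> R \<Longrightarrow> I_1 \<subseteq> Pol R R"
  by (simp add: I_1_def projections_subset_Pol constants_subset_Pol)

lemma L_clone_subset_Pol:
  assumes "\<And>r s. r \<in> R \<Longrightarrow> s \<in> R \<Longrightarrow> (\<lambda>i. r i \<noteq> s i) \<in> R" "(\<lambda>i. True) \<in> R"
  shows "L_clone \<subseteq> Pol R R"
  unfolding L_clone_def xor_fun_def
  using assms by (intro clone_generated_subset_Pol) (simp add: binary_in_Pol constants_subset_Pol)

lemma Lambda_clone_subset_Pol:
  assumes "\<And>r s. r \<in> R \<Longrightarrow> s \<in> R \<Longrightarrow> (\<lambda>i. r i \<and> s i) \<in> R" "\<And>c. (\<lambda>i. c) \<in> R"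
  shows "Lambda_clone \<subseteq> Pol R R"
  unfolding Lambda_clone_def and_fun_def
  using assms by (intro clone_generated_subset_Pol) (simp add: binary_in_Pol constants_subset_Pol)

lemma V_clone_subset_Pol:
  assumes "\<And>r s. r \<in> R \<Longrightarrow> s \<in> R \<Longrightarrow> (\<lambda>i. r i \<or> s i) \<in> R" "\<And>c. (\<lambda>i. c) \<in> R"
  shows "V_clone \<subseteq> Pol R R"
  unfolding V_clone_def or_fun_def
  using assms by (intro clone_generated_subset_Pol) (simp add: binary_in_Pol constants_subset_Pol)

text \<open>The set of all true points is the decisive choice of \<open>T\<close>: a nonzero meet
  has a coordinate \<open>k\<close> at which every true point is 1, so \<open>f\<close> lies below
  its \<open>k\<close>-th variable.\<close>

lemma U_inf_below_variable:
  assumes "f \<in> U_inf"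
  obtains k where "k < arity f" "\<And>a. a \<in> cube (arity f) \<Longrightarrow> app f a \<Longrightarrow> a ! k"
proof -
  let ?T = "{a \<in> cube (arity f). app f a}"
  have "meet (arity f) ?T \<noteq> replicate (arity f) False"
    using assms by (auto simp: U_inf_def)
  then obtain k where "k < arity f" "meet (arity f) ?T ! k"
    by (auto simp: list_eq_iff_nth_eq meet_def)
  then show ?thesis
    by (intro that[of k]) (auto simp: meet_def)
qed

text \<open>Dually, a coordinate at which all false points are 0 puts \<open>f\<close> above a
  variable.\<close>

lemma W_inf_above_variable:
  assumes "f \<in> W_inf"
  obtains k where "k < arity f" "\<And>a. a \<in> cube (arity f) \<Longrightarrow> a ! k \<Longrightarrow> app f a"
proof -
  let ?F = "{a \<in> cube (arity f). \<not> app f a}"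
  have "join (arity f) ?F \<noteq> replicate (arity f) True"
    using assms by (auto simp: W_inf_def)
  then obtain k where "k < arity f" "\<not> join (arity f) ?F ! k"
    by (auto simp: list_eq_iff_nth_eq join_def)
  then show ?thesis
    by (intro that[of k]) (auto simp: join_def)
qed

text \<open>Since \<open>f\<close> lies below a variable, its value on any tuple from
  \<open>S\<close> lies below one entry of that tuple; a downward closed \<open>S\<close> therefore
  absorbs it.\<close>

lemma U_inf_subset_Pol:
  assumes down: "\<And>s t. s \<in> S \<Longrightarrow> (\<And>i. t i \<Longrightarrow> s i) \<Longrightarrow> t \<in> S"
  shows "U_inf \<subseteq> Pol S S"
proof
  fix f assume f: "f \<in> U_inf"
  then obtain k where k: "k < arity f" "\<And>a. a \<in> cube (arity f) \<Longrightarrow> app f a \<Longrightarrow> a ! k"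
    using U_inf_below_variable by blast
  have "preserves S S f"
    unfolding preserves_def
  proof (intro allI impI)
    fix rs :: "('a \<Rightarrow> bool) list" assume rs: "length rs = arity f \<and> set rs \<subseteq> S"
    show "(\<lambda>i. app f (map (\<lambda>r. r i) rs)) \<in> S"
    proof (rule down)
      show "rs ! k \<in> S"
        using rs k by auto
      show "(rs ! k) i" if "app f (map (\<lambda>r. r i) rs)" for i
        using k(2)[OF _ that] rs k(1) by (simp add: cube_def)
    qed
  qed
  then show "f \<in> Pol S S"
    using f by (simp add: Pol_def U_inf_def)
qed

lemma W_inf_subset_Pol:
  assumes up: "\<And>s t. s \<in> S \<Longrightarrow> (\<And>i. s i \<Longrightarrow> t i) \<Longrightarrow> t \<in> S"
  shows "W_inf \<subseteq> Pol S S"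
proof
  fix f assume f: "f \<in> W_inf"
  then obtain k where k: "k < arity f" "\<And>a. a \<in> cube (arity f) \<Longrightarrow> a ! k \<Longrightarrow> app f a"
    using W_inf_above_variable by blast
  have "preserves S S f"
    unfolding preserves_def
  proof (intro allI impI)
    fix rs :: "('a \<Rightarrow> bool) list" assume rs: "length rs = arity f \<and> set rs \<subseteq> S"
    show "(\<lambda>i. app f (map (\<lambda>r. r i) rs)) \<in> S"
    proof (rule up)
      show "rs ! k \<in> S"
        using rs k by auto
      show "app f (map (\<lambda>r. r i) rs)" if "(rs ! k) i" for i
        using k(2)[of "map (\<lambda>r. r i) rs"] that rs k(1) by (simp add: cube_def)
    qed
  qed
  then show "f \<in> Pol S S"
    using f by (simp add: Pol_def W_inf_def)
qed

section \<open>Families of symmetric functions\<close>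

text \<open>
  The flags \<open>b\<close> and \<open>c\<close> are the dualities: \<open>False\<close> negates the inputs, respectively the output.
\<close>

definition sym_fun :: "bool \<Rightarrow> bool \<Rightarrow> nat \<Rightarrow> nat set \<Rightarrow> boolfun" where
  "sym_fun b c m W = mk_fun m (\<lambda>a. (card {j. j < length a \<and> a ! j = b} \<in> W) = c)"

text \<open>For \<open>b = False\<close> these are the pointwise complements of the elements of
  \<open>R\<close>, so one relation serves a case and its dual.\<close>

definition signed_rel :: "bool \<Rightarrow> ('i \<Rightarrow> bool) set \<Rightarrow> ('i \<Rightarrow> bool) set" where
  "signed_rel b R = {r. (\<lambda>i. r i = b) \<in> R}"

lemma signed_rel_True [simp]: "signed_rel True R = R"
  by (simp add: signed_rel_def)

text \<open>The negations built into \<open>sym_fun\<close> cancel those in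
  \<open>signed_rel\<close> on both the input and the output side, leaving a condition free of
  \<open>b\<close> and \<open>c\<close>.\<close>

lemma sym_fun_preserves_signed:
  "preserves (signed_rel b R) (signed_rel c S) (sym_fun b c m W) \<longleftrightarrow>
     (\<forall>rs. length rs = m \<and> set rs \<subseteq> R \<longrightarrow> (\<lambda>X. card {j. j < m \<and> (rs ! j) X} \<in> W) \<in> S)"
    (is "?lhs \<longleftrightarrow> ?rhs")
proof -
  have red: "((\<lambda>i. (card {j. j < length (map (\<lambda>r. r i) rs) \<and> map (\<lambda>r. r i) rs ! j = b} \<in> W) = c)
      \<in> signed_rel c S) \<longleftrightarrow> (\<lambda>X. card {j. j < length rs \<and> (rs ! j) X = b} \<in> W) \<in> S" for rs :: "('a \<Rightarrow> bool) list"
  proof -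
    have "{j. j < length (map (\<lambda>r. r i) rs) \<and> map (\<lambda>r. r i) rs ! j = b} =
        {j. j < length rs \<and> (rs ! j) i = b}" for i
      by auto
    moreover have "((P = c) = c) = P" for P :: bool
      by auto
    ultimately show ?thesis
      by (simp add: signed_rel_def)
  qed
  have flip: "{j. j < length rs \<and> (map (\<lambda>r X. r X = b) rs ! j) X = d} = {j. j < length rs \<and> ((rs ! j) X = b) = d}"
    for rs :: "('a \<Rightarrow> bool) list" and X d
    by auto
  have twice: "(\<lambda>X. (r X = b) = b) = r" for r :: "'a \<Rightarrow> bool"
    by auto
  show ?thesis
    unfolding sym_fun_def preserves_mk_fun red
  proof (intro iffI allI impI)
    fix rs :: "('a \<Rightarrow> bool) list"
    assume *: "\<forall>rs. length rs = m \<and> set rs \<subseteq> signed_rel b R \<longrightarrow>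
        (\<lambda>X. card {j. j < length rs \<and> (rs ! j) X = b} \<in> W) \<in> S"
      and rs: "length rs = m \<and> set rs \<subseteq> R"
    have "set (map (\<lambda>r X. r X = b) rs) \<subseteq> signed_rel b R"
      using rs by (auto simp: signed_rel_def twice)
    then have "(\<lambda>X. card {j. j < length rs \<and> ((rs ! j) X = b) = b} \<in> W) \<in> S"
      using *[rule_format, of "map (\<lambda>r X. r X = b) rs"] rs unfolding length_map flip by simp
    moreover have "((P = b) = b) = P" for P :: bool
      by auto
    ultimately show "(\<lambda>X. card {j. j < m \<and> (rs ! j) X} \<in> W) \<in> S"
      using rs by simp
  next
    fix rs :: "('a \<Rightarrow> bool) list"
    assume *: "\<forall>rs. length rs = m \<and> set rs \<subseteq> R \<longrightarrow> (\<lambda>X. card {j. j < m \<and> (rs ! j) X} \<in> W) \<in> S"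
      and rs: "length rs = m \<and> set rs \<subseteq> signed_rel b R"
    have "set (map (\<lambda>r X. r X = b) rs) \<subseteq> R"
      using rs by (auto simp: signed_rel_def)
    moreover have "{j. j < m \<and> (map (\<lambda>r X. r X = b) rs ! j) X} = {j. j < m \<and> (rs ! j) X = b}" for X
      using rs by auto
    ultimately show "(\<lambda>X. card {j. j < length rs \<and> (rs ! j) X = b} \<in> W) \<in> S"
      using *[rule_format, of "map (\<lambda>r X. r X = b) rs"] rs by simp
  qed
qed

text \<open>
  The points of the \<open>n\<close>-cube are encoded as the subsets of \<open>{..<n}\<close>, and an \<open>m\<close>-tuple of \<open>n\<close>-ary
  functions as a map \<open>A\<close> from sets to subsets of \<open>{..<m}\<close>.
\<close>

definition tuple_map :: "(nat set \<Rightarrow> bool) list \<Rightarrow> nat set \<Rightarrow> nat set" where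
  "tuple_map rs X = {j. j < length rs \<and> (rs ! j) X}"

lemma tuple_map_subset: "tuple_map rs X \<subseteq> {..<length rs}"
  by (auto simp: tuple_map_def)

text \<open>Enumerates the odd numbers from 5 on. Oddness serves the affine case; the lower bound
  keeps small cardinalities apart from \<open>n - 1\<close> and \<open>n\<close>.\<close>

abbreviation ar :: "nat \<Rightarrow> nat" where
  "ar n \<equiv> 2 * n + 5"

text \<open>Substituting the coordinate functions reproduces the symmetric function of arity
  \<open>n\<close>, which \<open>notin\<close> excludes from \<open>S n\<close>; \<open>inS\<close>
  covers all other arities. Only these facts and the invariance of the relations remain to be shown
  in each case.\<close>

lemma uncountable_clonoids_symmetric:
  fixes R S :: "nat \<Rightarrow> (nat set \<Rightarrow> bool) set" and W :: "nat \<Rightarrow> nat set"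
  assumes C1: "\<And>n. n \<ge> 5 \<Longrightarrow> C1 \<subseteq> Pol (signed_rel b (R n)) (signed_rel b (R n))"
    and C2: "\<And>n. n \<ge> 5 \<Longrightarrow> C2 \<subseteq> Pol (signed_rel c (S n)) (signed_rel c (S n))"
    and vars: "\<And>n i. i < n \<Longrightarrow> (\<lambda>X. i \<in> X) \<in> R n"
    and notin: "\<And>n. n \<ge> 5 \<Longrightarrow> (\<lambda>X. card (X \<inter> {..<n}) \<in> W n) \<notin> S n"
    and inS: "\<And>m n rs. \<lbrakk>odd m; odd n; 5 \<le> m; 5 \<le> n; m \<noteq> n; length rs = m; set rs \<subseteq> R n\<rbrakk>
                \<Longrightarrow> (\<lambda>X. card (tuple_map rs X) \<in> W m) \<in> S n"
  shows "uncountable {K. clonoid C1 C2 K}"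
proof (rule uncountable_clonoids)
  show "C1 \<subseteq> Pol (signed_rel b (R (ar n))) (signed_rel b (R (ar n)))" for n
    by (rule C1) simp
  show "C2 \<subseteq> Pol (signed_rel c (S (ar n))) (signed_rel c (S (ar n)))" for n
    by (rule C2) simp
  show "sym_fun b c (ar m) (W (ar m)) \<in> Pol (signed_rel b (R (ar n))) (signed_rel c (S (ar n)))
      \<longleftrightarrow> m \<noteq> n" for m n
  proof -
    have "sym_fun b c (ar m) (W (ar m)) \<in> boolfuns"
      by (simp add: sym_fun_def mk_fun_in_boolfuns)
    then have "sym_fun b c (ar m) (W (ar m)) \<in> Pol (signed_rel b (R (ar n))) (signed_rel c (S (ar n)))
        \<longleftrightarrow> (\<forall>rs. length rs = ar m \<and> set rs \<subseteq> R (ar n) \<longrightarrow>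
        (\<lambda>X. card {j. j < ar m \<and> (rs ! j) X} \<in> W (ar m)) \<in> S (ar n))"
      unfolding Pol_def mem_Collect_eq sym_fun_preserves_signed by simp
    also have "\<dots> \<longleftrightarrow> m \<noteq> n"
    proof (cases "m = n")
      case True
      \<comment> \<open>The tuple of all coordinate functions encodes the identity
        substitution.\<close>
      let ?rs = "map (\<lambda>i X. i \<in> X) [0..<ar n]"
      have "{j. j < ar n \<and> (?rs ! j) X} = X \<inter> {..<ar n}" for X
        by (auto simp del: upt_Suc)
      then have "(\<lambda>X. card {j. j < ar n \<and> (?rs ! j) X} \<in> W (ar n)) \<notin> S (ar n)"
        using notin[of "ar n"] by simp
      moreover have "length ?rs = ar n \<and> set ?rs \<subseteq> R (ar n)"
        using vars by (auto simp del: upt_Suc)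
      ultimately show ?thesis
        using True by blast
    next
      case False
      then show ?thesis
        using inS[of "ar m" "ar n"] by (auto simp: tuple_map_def)
    qed
    finally show ?thesis .
  qed
qed

text \<open>Avoids the symmetric function and also its negation on the \<open>n\<close>-cube, which
  makes the set closed under negation.\<close>

definition neq_rel :: "(nat \<Rightarrow> nat set) \<Rightarrow> nat \<Rightarrow> (nat set \<Rightarrow> bool) set" where
  "neq_rel W n = {s. \<not> (\<exists>c. \<forall>X\<subseteq>{..<n}. s X = ((card X \<in> W n) = c))}"

text \<open>A Horn implication between values of \<open>s\<close>, hence stable under pointwise
  conjunction. The symmetric function violates it when \<open>0\<close> is not in
  \<open>W n\<close>.\<close>

definition horn_rel :: "(nat \<Rightarrow> nat set) \<Rightarrow> nat \<Rightarrow> (nat set \<Rightarrow> bool) set" where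
  "horn_rel W n = {s. (\<forall>X\<subseteq>{..<n}. card X \<in> W n \<longrightarrow> s X) \<longrightarrow> s {}}"

text \<open>On the \<open>n\<close>-cube, the functions that are not above the symmetric function:
  the largest downward closed set avoiding it.\<close>

definition zero_rel :: "(nat \<Rightarrow> nat set) \<Rightarrow> nat \<Rightarrow> (nat set \<Rightarrow> bool) set" where
  "zero_rel W n = {s. \<exists>X\<subseteq>{..<n}. card X \<in> W n \<and> \<not> s X}"


section \<open>Affine substitutions\<close>

lemma card_eq_pred_iff:
  assumes "Y \<subseteq> {..<m}" "1 \<le> m"
  shows "card Y = m - 1 \<longleftrightarrow> (\<exists>x<m. Y = {..<m} - {x})"
proof
  assume "card Y = m - 1"
  moreover have "finite Y"
    using assms finite_subset by blast
  ultimately have "card ({..<m} - Y) = 1"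
    using assms by (simp add: card_Diff_subset)
  then obtain x where x: "{..<m} - Y = {x}"
    by (auto simp: card_1_singleton_iff)
  then have "x < m" "Y = {..<m} - {x}"
    using assms by auto
  then show "\<exists>x<m. Y = {..<m} - {x}"
    by blast
qed (use assms in auto)

lemma card_eq_full_iff: "Y \<subseteq> {..<m} \<Longrightarrow> card Y = m \<longleftrightarrow> Y = {..<m}"
  by (metis card_lessThan card_subset_eq finite_lessThan)

lemma card_1_or_full:
  assumes "Y \<subseteq> {..<m}" "card Y \<in> {1, m}"
  shows "Y = {..<m} \<or> (\<exists>x<m. Y = {x})"
proof (cases "card Y = 1")
  case True
  then obtain x where "Y = {x}"
    using card_1_singletonE by blast
  then show ?thesis
    using assms(1) by blast
next
  case False
  then show ?thesis
    using assms card_eq_full_iff by blast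
qed

text \<open>The singletons together with \<open>{..<m}\<close> form an affine circuit when \<open>m\<close> is odd.\<close>

lemma circuit_triple:
  assumes "card X \<in> {1, m}" "card Y \<in> {1, m}" "card Z \<in> {1, m}"
    and "X \<subseteq> {..<m}" "Y \<subseteq> {..<m}" "Z \<subseteq> {..<m}" "5 \<le> m"
    and "X \<noteq> Y" "X \<noteq> Z" "Y \<noteq> Z"
  shows "card (sym_diff X (sym_diff Y Z)) \<notin> {1, m}"
proof -
  \<comment> \<open>The sum of three distinct circuit points has \<open>m - 2\<close> elements if
    one of them is \<open>{..<m}\<close>, and 3 elements if all are singletons. For \<open>m\<close>
    at least 5 neither number is 1 or \<open>m\<close>.\<close>
  have two: "card (sym_diff {..<m} (sym_diff {x} {y})) \<notin> {1, m}" if "x \<noteq> y" "x < m" "y < m" for x y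
  proof -
    have eq: "sym_diff {..<m} (sym_diff {x} {y}) = {..<m} - {x, y}"
      using that by blast
    have "card ({..<m} - {x, y}) = card {..<m} - card {x, y}"
      by (rule card_Diff_subset) (use that in simp_all)
    then have card: "card ({..<m} - {x, y}) = m - 2"
      using that(1) by simp
    show ?thesis
      unfolding eq card using \<open>5 \<le> m\<close> by auto
  qed
  have three: "card (sym_diff {x} (sym_diff {y} {z})) \<notin> {1, m}" if "x \<noteq> y" "y \<noteq> z" "x \<noteq> z" for x y z
  proof -
    have eq: "sym_diff {x} (sym_diff {y} {z}) = {x, y, z}"
      using that by blast
    have card: "card {x, y, z} = 3"
      using that by simp
    show ?thesis
      unfolding eq card using \<open>5 \<le> m\<close> by auto
  qed
  have perm: "sym_diff X (sym_diff Y Z) = sym_diff Y (sym_diff X Z)"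
    "sym_diff X (sym_diff Y Z) = sym_diff Z (sym_diff X Y)"
    by auto
  have X: "X = {..<m} \<or> (\<exists>x<m. X = {x})" and Y: "Y = {..<m} \<or> (\<exists>x<m. Y = {x})"
    and Z: "Z = {..<m} \<or> (\<exists>x<m. Z = {x})"
    using card_1_or_full assms(1-6) by blast+
  show ?thesis
  proof (cases "X = {..<m}")
    case True
    then obtain y z where "Y = {y}" "y < m" "Z = {z}" "z < m"
      using Y Z assms(8,9) by blast
    then show ?thesis
      using two[of y z] assms(10) True by simp
  next
    case nX: False
    then obtain x where x: "X = {x}" "x < m"
      using X by blast
    show ?thesis
    proof (cases "Y = {..<m}")
      case True
      then obtain z where "Z = {z}" "z < m"
        using Z assms(10) by blast
      then show ?thesis
        using two[of x z] x assms(9) True unfolding perm(1) by simp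
    next
      case False
      then obtain y where y: "Y = {y}" "y < m"
        using Y by blast
      show ?thesis
      proof (cases "Z = {..<m}")
        case True
        then show ?thesis
          using two[of x y] x y assms(8) unfolding perm(2) by simp
      next
        case False
        then obtain z where "Z = {z}"
          using Z by blast
        then show ?thesis
          using three[of x y z] x y assms(8-10) by simp
      qed
    qed
  qed
qed

text \<open>The map \<open>A\<close> turns out to be injective and \<open>c\<close> true, so
  \<open>A\<close> embeds the \<open>n + 1\<close> circuit points of the \<open>n\<close>-cube into
  the \<open>m + 1\<close> points of the target. Their images sum to zero, and no proper nonempty
  part of the target set does, so the sizes agree.\<close>

lemma affine_pullback_circuit:
  fixes A :: "nat set \<Rightarrow> nat set"
  assumes aff: "\<And>X Y Z. A (sym_diff X (sym_diff Y Z)) = sym_diff (A X) (sym_diff (A Y) (A Z))"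
    and sub: "\<And>X. A X \<subseteq> {..<m}"
    and n: "odd n" "5 \<le> n" and m: "5 \<le> m"
    and eq: "\<And>X. X \<subseteq> {..<n} \<Longrightarrow> (card (A X) \<in> {1, m}) = ((card X \<in> {1, n}) = c)"
  shows "m = n"
proof -
  \<comment> \<open>If \<open>A X = A Y\<close>, translation by \<open>?D\<close> preserves the
    circuit. Translating \<open>{i}\<close> with \<open>i\<close> in \<open>?D\<close> forces
    \<open>card ?D = 2\<close>; translating \<open>{l}\<close> with \<open>l\<close> outside
    \<open>?D\<close> then gives a 3-element circuit point, impossible for \<open>n\<close> at least
    5.\<close>
  have inj: "X = Y" if XY: "X \<subseteq> {..<n}" "Y \<subseteq> {..<n}" "A X = A Y" for X Y
  proof (rule ccontr)
    assume "X \<noteq> Y"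
    let ?D = "sym_diff X Y"
    have inv: "card (sym_diff Z ?D) \<in> {1, n} \<longleftrightarrow> card Z \<in> {1, n}" if "Z \<subseteq> {..<n}" for Z
    proof -
      have "A (sym_diff Z ?D) = A Z"
        using aff[of Z X Y] XY(3) by auto
      moreover have "sym_diff Z ?D \<subseteq> {..<n}"
        using XY that by auto
      ultimately show ?thesis
        using eq[of Z] eq[of "sym_diff Z ?D"] that by auto
    qed
    have fin: "finite ?D" and Dn: "?D \<subseteq> {..<n}"
      using XY finite_subset[of _ "{..<n}"] by auto
    obtain i where i: "i \<in> ?D"
      using \<open>X \<noteq> Y\<close> by auto
    have "sym_diff {i} ?D = ?D - {i}"
      using i by auto
    then have "card ?D - 1 \<in> {1, n}"
      using inv[of "{i}"] i Dn fin by (auto simp: card_Diff_singleton)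
    moreover have "card ?D \<le> n"
      using card_mono[OF _ Dn] by simp
    ultimately have D2: "card ?D = 2"
      using n by auto
    then have "\<not> {..<n} \<subseteq> ?D"
      using card_mono[OF fin, of "{..<n}"] n by auto
    then obtain l where l: "l < n" "l \<notin> ?D"
      by blast
    then have "sym_diff {l} ?D = insert l ?D"
      by auto
    then have "card (insert l ?D) \<in> {1, n}"
      using inv[of "{l}"] l by simp
    then show False
      using l fin D2 n by (simp add: card_insert_disjoint)
  qed
  \<comment> \<open>Otherwise points off the source circuit map onto the target circuit. The sets
    \<open>{}\<close>, \<open>{0, 1}\<close>, \<open>{1, 2}\<close> and their sum
    \<open>{0, 2}\<close> are such points, contradicting \<open>circuit_triple\<close>.\<close>
  have c: c
  proof (rule ccontr)
    assume "\<not> c"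
    then have B: "card (A X) \<in> {1, m}" if "X \<subseteq> {..<n}" "card X \<notin> {1, n}" for X
      using eq[OF that(1)] that(2) by simp
    have "A {} \<noteq> A {0, 1}" "A {} \<noteq> A {1, 2}" "A {0, 1} \<noteq> A {1, 2}"
    proof -
      have ne: "A X \<noteq> A Y" if "X \<subseteq> {..<n}" "Y \<subseteq> {..<n}" "X \<noteq> Y" for X Y
        using inj[OF that(1,2)] that(3) by blast
      have "{} \<noteq> {0, 1::nat}" "{} \<noteq> {1, 2::nat}" "{0, 1} \<noteq> {1, 2::nat}"
        by (simp_all add: doubleton_eq_iff)
      then show "A {} \<noteq> A {0, 1}" "A {} \<noteq> A {1, 2}" "A {0, 1} \<noteq> A {1, 2}"
        using n by (intro ne; simp)+
    qed
    moreover have "sym_diff {} (sym_diff {0, 1} {1, 2}) = {0, 2::nat}"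
      by auto
    then have "sym_diff (A {}) (sym_diff (A {0, 1}) (A {1, 2})) = A {0, 2}"
      using aff[of "{}" "{0, 1}" "{1, 2}"] by simp
    moreover have "card (A {}) \<in> {1, m}" "card (A {0, 1}) \<in> {1, m}" "card (A {1, 2}) \<in> {1, m}"
      "card (A {0, 2}) \<in> {1, m}"
      using n by (intro B; auto)+
    ultimately show False
      using circuit_triple[of "A {}" m "A {0, 1}" "A {1, 2}"] sub m by metis
  qed
  \<comment> \<open>\<open>I\<close> is the image of the source circuit and \<open>B\<close> the
    target circuit; the aim is \<open>I = B\<close>.\<close>
  define I where "I = insert (A {..<n}) ((\<lambda>i. A {i}) ` {..<n})"
  define B where "B = insert {..<m} ((\<lambda>j. {j}) ` {..<m})"
  have inj_pt: "i = k" if "i < n" "k < n" "A {i} = A {k}" for i k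
    using inj[of "{i}" "{k}"] that by simp
  then have "inj_on (\<lambda>i. A {i}) {..<n}"
    by (simp add: inj_on_def)
  moreover have notin: "A {..<n} \<notin> (\<lambda>i. A {i}) ` {..<n}"
  proof
    assume "A {..<n} \<in> (\<lambda>i. A {i}) ` {..<n}"
    then obtain i where i: "i < n" "A {..<n} = A {i}"
      by blast
    have "{..<n} = {i}"
      by (rule inj[OF order_refl _ i(2)]) (use i(1) in simp)
    then have "card {..<n} = card {i}"
      by simp
    then show False
      using n by simp
  qed
  ultimately have cardI: "card I = Suc n"
    by (simp add: I_def card_image)
  have not_single: "{..<m} \<noteq> {j}" for j
  proof
    assume "{..<m} = {j}"
    then have "card {..<m} = card {j}"
      by simp
    then show False
      using m by simp
  qed
  then have cardB: "card B = Suc m"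
    by (subst B_def, subst card_insert_disjoint) (auto simp: card_image)
  have IB: "I \<subseteq> B"
  proof -
    have "card (A {i}) \<in> {1, m}" if "i < n" for i
      using eq[of "{i}"] c that by simp
    moreover have "card (A {..<n}) \<in> {1, m}"
      using eq[of "{..<n}"] c by simp
    moreover have "Y \<in> B" if "card Y \<in> {1, m}" "Y \<subseteq> {..<m}" for Y
      using card_1_or_full[OF that(2,1)] by (auto simp: B_def)
    ultimately show ?thesis
      using sub by (auto simp: I_def)
  qed
  text \<open>An affine map preserves sums of an odd number of points.\<close>
  have prefix: "j \<in> A {..<k} \<longleftrightarrow> (odd (card {i. i < k \<and> j \<in> A {i}}) \<noteq> (even k \<and> j \<in> A {}))" for j k
  proof (induction k)
    case 0
    then show ?case by simp
  next
    case (Suc k)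
    have "{..<Suc k} = sym_diff {..<k} (sym_diff {} {k})"
      by auto
    then have "j \<in> A {..<Suc k} \<longleftrightarrow> (j \<in> A {..<k} \<longleftrightarrow> (j \<in> A {} \<longleftrightarrow> j \<in> A {k}))"
      using aff[of "{..<k}" "{}" "{k}"] by auto
    moreover have "{i. i < Suc k \<and> j \<in> A {i}} =
        (if j \<in> A {k} then insert k {i. i < k \<and> j \<in> A {i}} else {i. i < k \<and> j \<in> A {i}})"
      by (auto simp: less_Suc_eq)
    then have "odd (card {i. i < Suc k \<and> j \<in> A {i}}) \<longleftrightarrow>
        (odd (card {i. i < k \<and> j \<in> A {i}}) \<noteq> (j \<in> A {k}))"
      by auto
    ultimately show ?case
      using Suc.IH by auto
  qed
  \<comment> \<open>For odd \<open>n\<close>, \<open>prefix\<close> makes \<open>A {..<n}\<close>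
    the sum modulo 2 of the \<open>A {i}\<close>, so the members of \<open>I\<close> sum to
    zero.\<close>
  have parity: "even (card {Y \<in> I. j \<in> Y})" for j
  proof -
    have "{Y \<in> (\<lambda>i. A {i}) ` {..<n}. j \<in> Y} = (\<lambda>i. A {i}) ` {i. i < n \<and> j \<in> A {i}}"
      by auto
    moreover have "inj_on (\<lambda>i. A {i}) {i. i < n \<and> j \<in> A {i}}"
      using inj_pt by (simp add: inj_on_def)
    ultimately have *: "card {Y \<in> (\<lambda>i. A {i}) ` {..<n}. j \<in> Y} = card {i. i < n \<and> j \<in> A {i}}"
      by (simp add: card_image)
    have "{Y \<in> I. j \<in> Y} = (if j \<in> A {..<n} then insert (A {..<n}) {Y \<in> (\<lambda>i. A {i}) ` {..<n}. j \<in> Y}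
        else {Y \<in> (\<lambda>i. A {i}) ` {..<n}. j \<in> Y})"
      by (auto simp: I_def)
    then show ?thesis
      using notin prefix[of j n] n * by auto
  qed
  \<comment> \<open>Only \<open>{j}\<close> and \<open>{..<m}\<close> in \<open>B\<close> contain
    \<open>j\<close>, so by parity \<open>I\<close> contains both or neither.\<close>
  have iff: "{j} \<in> I \<longleftrightarrow> {..<m} \<in> I" if "j < m" for j
  proof -
    have "{j} \<noteq> {..<m}"
      using not_single by metis
    have "{Y \<in> I. j \<in> Y} = I \<inter> {{j}, {..<m}}"
      using IB that by (auto simp: B_def)
    then have "even (card (I \<inter> {{j}, {..<m}}))"
      using parity[of j] by simp
    then show ?thesis
      using \<open>{j} \<noteq> {..<m}\<close> by (auto simp: Int_insert_right split: if_splits)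
  qed
  have "I \<noteq> {}"
    by (simp add: I_def)
  then have "{..<m} \<in> I"
    using IB iff by (auto simp: B_def)
  then have "I = B"
    using IB iff by (auto simp: B_def)
  then show ?thesis
    using cardI cardB by simp
qed

section \<open>Substitutions of literals and constants\<close>

text \<open>Here \<open>a\<close> is the value at the zero point and \<open>T i\<close> the
  positions changed by switching on coordinate \<open>i\<close>. If \<open>a\<close> is empty, all
  \<open>T i\<close> are singletons and their union has \<open>n\<close> elements. Otherwise
  \<open>a\<close> has two elements and misses a point, and each of too many disjoint sets would
  have to meet these three points.\<close>

lemma disjoint_flips:
  fixes T :: "nat \<Rightarrow> nat set"
  assumes a: "a \<subseteq> {..<m}" "card a \<notin> {1, m}"
    and T: "\<And>i. T i \<subseteq> {..<m}" "\<And>i k. i \<noteq> k \<Longrightarrow> T i \<inter> T k = {}"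
    and point: "\<And>i. i < n \<Longrightarrow> card (sym_diff a (T i)) \<in> {1, m}"
    and top: "card (sym_diff a (\<Union>i<n. T i)) \<in> {1, m}"
    and n: "5 \<le> n"
  shows "m = n"
proof -
  have sub: "sym_diff a (T i) \<subseteq> {..<m}" for i
    using a(1) T(1) by blast
  have fin: "finite a" "finite (T i)" for i
    using a(1) T(1) by (auto intro: finite_subset[OF _ finite_lessThan])
  show ?thesis
  proof (cases "a = {}")
    case True
    have "m \<noteq> 0"
      using a(2) True by auto
    have "card (T i) = 1" if i: "i < n" for i
    proof -
      have pt: "T i = {..<m} \<or> (\<exists>x<m. T i = {x})" if "i < n" for i
        using card_1_or_full[OF T(1)] point[OF that] True by simp
      have "T i \<noteq> {..<m}"
      proof
        assume Ti: "T i = {..<m}"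
        obtain k where k: "k < n" "k \<noteq> i"
          using n that[of 0] that[of 1] by (cases "i = 0") auto
        then have "T k = {}"
          using T(1)[of k] T(2)[of k i] unfolding Ti by blast
        then show False
          using pt[OF k(1)] \<open>m \<noteq> 0\<close> by auto
      qed
      then obtain x where "T i = {x}"
        using pt[OF i] by blast
      then show ?thesis
        by simp
    qed
    then have "card (\<Union>i<n. T i) = n"
      using T(2) fin by (subst card_UN_disjoint) auto
    then show ?thesis
      using top True n by simp
  next
    case False
    then have "card a \<noteq> 0" "card a \<noteq> 1"
      using a(2) fin(1) by simp_all
    then have "\<not> card a \<le> Suc 0"
      by simp
    then obtain x y where xy: "x \<in> a" "y \<in> a" "x \<noteq> y"
      using card_le_Suc0_iff_eq[OF fin(1)] by blast
    have "a \<noteq> {..<m}"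
      using a(2) by auto
    then obtain z where z: "z < m" "z \<notin> a"
      using a(1) by blast
    \<comment> \<open>A flip avoiding all three points leaves \<open>x\<close> and \<open>y\<close>
      in and \<open>z\<close> out, so the result is neither a singleton nor
      \<open>{..<m}\<close>.\<close>
    have hit: "x \<in> T i \<or> y \<in> T i \<or> z \<in> T i" if "i < n" for i
    proof (rule ccontr)
      assume "\<not> ?thesis"
      then have "x \<in> sym_diff a (T i)" "y \<in> sym_diff a (T i)" "z \<notin> sym_diff a (T i)"
        using xy z by blast+
      then show False
        using card_1_or_full[OF sub point[OF that]] xy(3) z(1) by (metis lessThan_iff singletonD)
    qed
    text \<open>Three points cannot meet four disjoint sets.\<close>
    have "\<forall>i\<in>{..<4}. \<exists>w. w \<in> {x, y, z} \<and> w \<in> T i"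
    proof
      fix i :: nat assume "i \<in> {..<4}"
      then have "i < n"
        using n by simp
      then show "\<exists>w. w \<in> {x, y, z} \<and> w \<in> T i"
        using hit[of i] by blast
    qed
    then obtain g where g: "\<forall>i\<in>{..<4}. g i \<in> {x, y, z} \<and> g i \<in> T i"
      by (rule bchoice[THEN exE])
    have "inj_on g {..<4}"
    proof (rule inj_onI, rule ccontr)
      fix i k assume "i \<in> {..<4}" "k \<in> {..<4}" "g i = g k" "i \<noteq> k"
      then have "g i \<in> T i \<inter> T k"
        using g by (metis IntI)
      then show False
        using T(2)[OF \<open>i \<noteq> k\<close>] by simp
    qed
    then have "card {..<4::nat} \<le> card {x, y, z}"
      using g by (intro card_inj_on_le[of g]) auto
    moreover have "card {x, y, z} \<le> 3"
      by (simp add: card_insert_if)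
    ultimately show ?thesis
      by simp
  qed
qed

text \<open>If \<open>a\<close> is \<open>{..<m}\<close>, nonempty flips are complements of points,
  and two of them intersect. If \<open>a\<close> is \<open>{x}\<close>, the flip containing
  \<open>x\<close> has two elements and all others are empty. Neither situation allows a disjoint
  cover of at least 5 points.\<close>

lemma disjoint_flips_covering:
  fixes T :: "nat \<Rightarrow> nat set"
  assumes a: "a \<subseteq> {..<m}" "card a \<in> {1, m}"
    and T: "\<And>i k. i \<noteq> k \<Longrightarrow> T i \<inter> T k = {}"
    and point: "\<And>i. i < n \<Longrightarrow> card (sym_diff a (T i)) \<in> {1, m}"
    and cover: "(\<Union>i<n. T i) = {..<m}"
    and m: "5 \<le> m"
  shows False
proof -
  have pt: "sym_diff a (T i) = {..<m} \<or> (\<exists>x. sym_diff a (T i) = {x})" if "i < n" for i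
  proof -
    have "sym_diff a (T i) \<subseteq> {..<m}"
      using a cover that by auto
    then show ?thesis
      using card_1_or_full point[OF that] by blast
  qed
  consider "a = {..<m}" | x where "a = {x}"
    using card_1_or_full[OF a] by blast
  then show ?thesis
  proof cases
    case 1
    have big: "\<exists>x. T i = {..<m} - {x}" if i: "i < n" "T i \<noteq> {}" for i
      using pt[OF i(1)] i cover unfolding 1 by blast
    obtain i where i: "i < n" "0 \<in> T i"
      using cover m by (metis UN_iff lessThan_iff less_le_trans zero_less_numeral)
    then obtain x where x: "T i = {..<m} - {x}"
      using big by blast
    have "x < m"
    proof (rule ccontr)
      assume "\<not> x < m"
      then have "T i = {..<m}"
        using x by simp
      moreover have "0 \<in> {..<m}"
        using m by simp
      ultimately show False
        using pt[OF i(1)] unfolding 1 by blast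
    qed
    then obtain k where k: "k < n" "x \<in> T k"
      using cover by blast
    then obtain y where y: "T k = {..<m} - {y}"
      using big by blast
    have "k \<noteq> i"
      using x k by auto
    have "\<not> {..<m} \<subseteq> {x, y}"
      using card_mono[of "{x, y}" "{..<m}"] m by (auto simp: card_insert_if split: if_splits)
    then show False
      using T[OF \<open>k \<noteq> i\<close>] x y by blast
  next
    case 2
    then have "x < m"
      using a by auto
    then obtain i where i: "i < n" "x \<in> T i"
      using cover by blast
    have "x \<notin> sym_diff a (T i)"
      using i 2 by auto
    then obtain y where y: "sym_diff a (T i) = {y}"
      using pt[OF i(1)] \<open>x < m\<close> by auto
    then have Ti: "T i = {x, y}" "y \<noteq> x"
      using i 2 by auto
    \<comment> \<open>A further nonempty flip would leave \<open>x\<close> in, add some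
      \<open>t\<close>, and still miss \<open>y\<close>, giving neither a singleton nor
      \<open>{..<m}\<close>.\<close>
    have Tk: "T k = {}" if k: "k < n" "k \<noteq> i" for k
    proof (rule ccontr)
      assume "T k \<noteq> {}"
      then obtain t where t: "t \<in> T k"
        by blast
      have xy: "x \<notin> T k" "y \<notin> T k"
        using T[OF k(2)] unfolding Ti(1) by blast+
      have "y < m"
        using Ti(1) i(1) cover by blast
      moreover have "x \<in> sym_diff a (T k)" "t \<in> sym_diff a (T k)" "y \<notin> sym_diff a (T k)"
        using xy t Ti(2) unfolding 2 by blast+
      moreover have "t \<noteq> x"
        using xy t by blast
      ultimately show False
        using pt[OF k(1)] by (metis lessThan_iff singletonD)
    qed
    have "{..<m} = {x, y}"
      using cover Ti Tk i by blast
    then have "card {..<m} = card {x, y}"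
      by simp
    then show False
      using m Ti by simp
  qed
qed

section \<open>Meet-preserving substitutions\<close>

text \<open>The conditions force \<open>A\<close> to send the empty set to itself, atoms to atoms
  and coatoms to their complements. The atoms \<open>A {i}\<close> then partition
  \<open>{..<m}\<close> into \<open>n\<close> singletons.\<close>

lemma meet_pullback_implies_eq:
  fixes A :: "nat set \<Rightarrow> nat set"
  assumes meet: "\<And>X Y. A (X \<inter> Y) = A X \<inter> A Y"
    and sub: "\<And>X. A X \<subseteq> {..<m}"
    and n: "5 \<le> n" and m: "5 \<le> m"
    and up: "\<And>X. X \<subseteq> {..<n} \<Longrightarrow> card X \<in> {1, n - 1} \<Longrightarrow> card (A X) \<in> {1, m - 1}"
    and bot: "card (A {}) \<notin> {1, m - 1}"
  shows "m = n"
proof -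
  have mono: "A X \<subseteq> A Y" if "X \<subseteq> Y" for X Y
    using meet[of X Y] that unfolding Int_absorb2[OF that] by blast
  have fin: "finite (A X)" for X
    using sub finite_subset by blast
  have pt: "card (A {i}) \<in> {1, m - 1}" if "i < n" for i
    using up[of "{i}"] that by simp
  have disj: "A {i} \<inter> A {k} = A {}" if "i \<noteq> k" for i k
    using meet[of "{i}" "{k}"] that by simp
  \<comment> \<open>If \<open>A {}\<close> were nonempty, every \<open>A {i}\<close> would be a
    coatom. The point missing from \<open>A {0}\<close> is missing from \<open>A {1}\<close> or
    \<open>A {2}\<close> too, so two of these coatoms coincide and equal their meet
    \<open>A {}\<close>, against \<open>bot\<close>.\<close>
  have empty: "A {} = {}"
  proof (rule ccontr)
    assume ne: "A {} \<noteq> {}"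
    have ge: "\<exists>x<m. A {i} = {..<m} - {x}" if "i < n" for i
    proof -
      have "card (A {i}) \<noteq> 1"
      proof
        assume "card (A {i}) = 1"
        then obtain x where "A {i} = {x}"
          by (auto simp: card_1_singleton_iff)
        then have "A {} = {x}"
          using mono[of "{}" "{i}"] ne by auto
        then show False
          using bot by simp
      qed
      then show ?thesis
        using pt[OF that] card_eq_pred_iff[OF sub] m by auto
    qed
    obtain x where x: "x < m" "A {0} = {..<m} - {x}"
      using ge[of 0] n by auto
    have "x \<notin> A {1} \<or> x \<notin> A {2}"
      using x mono[of "{}" "{0}"] disj[of 1 2] by auto
    then obtain k where k: "k \<noteq> 0" "k < n" "x \<notin> A {k}"
      using n that[of 1] that[of 2] by auto
    then have "A {k} = A {0}"
      using ge[OF k(2)] x by auto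
    then have "A {} = A {0}"
      using disj[OF k(1)] by simp
    then show False
      using bot pt[of 0] n by simp
  qed
  \<comment> \<open>A coatom \<open>A {i}\<close> would leave a single point for two further
    disjoint sets \<open>A {k}\<close> and \<open>A {l}\<close>, making one of them empty.\<close>
  have one: "card (A {i}) = 1" if i: "i < n" for i
  proof (rule ccontr)
    assume "card (A {i}) \<noteq> 1"
    then obtain x where x: "A {i} = {..<m} - {x}"
      using pt[OF i] card_eq_pred_iff[OF sub] m by auto
    \<comment> \<open>The witnesses are the two least indices other than \<open>i\<close>.\<close>
    obtain k l where kl: "k < n" "l < n" "k \<noteq> l" "k \<noteq> i" "l \<noteq> i"
    proof -
      have "\<exists>k l. k < n \<and> l < n \<and> k \<noteq> l \<and> k \<noteq> i \<and> l \<noteq> i"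
        by (rule exI[of _ "if i = 0 then 1 else 0"], rule exI[of _ "if i \<le> 1 then 2 else 1"])
          (use n in auto)
      then show ?thesis
        using that by blast
    qed
    have "A {k} \<subseteq> {x}" "A {l} \<subseteq> {x}" "A {k} \<inter> A {l} = {}"
      using disj[of k i] disj[of l i] disj[of k l] kl empty x sub[of "{k}"] sub[of "{l}"] by auto
    then have "A {k} = {} \<or> A {l} = {}"
      by blast
    then show False
      using pt[OF kl(1)] pt[OF kl(2)] m by auto
  qed
  \<comment> \<open>This set contains two disjoint atoms, so it is no singleton; being a coatom
    disjoint from \<open>A {i}\<close>, it is the complement of \<open>A {i}\<close>.\<close>
  have coatom: "A ({..<n} - {i}) = {..<m} - A {i}" if i: "i < n" for i
  proof -
    let ?Y = "A ({..<n} - {i})"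
    have "card ?Y \<in> {1, m - 1}"
      using up[of "{..<n} - {i}"] i by auto
    moreover have "card ?Y \<noteq> 1"
    proof
      assume "card ?Y = 1"
      then obtain x where x: "?Y = {x}"
        by (auto simp: card_1_singleton_iff)
      obtain k l where kl: "k < n" "l < n" "k \<noteq> l" "k \<noteq> i" "l \<noteq> i"
      proof -
        have "\<exists>k l. k < n \<and> l < n \<and> k \<noteq> l \<and> k \<noteq> i \<and> l \<noteq> i"
          by (rule exI[of _ "if i = 0 then 1 else 0"], rule exI[of _ "if i \<le> 1 then 2 else 1"])
          (use n in auto)
        then show ?thesis
          using that by blast
      qed
      have "A {k} \<subseteq> {x}" "A {l} \<subseteq> {x}"
        using mono[of "{k}" "{..<n} - {i}"] mono[of "{l}" "{..<n} - {i}"] kl x by auto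
      moreover have "A {k} \<inter> A {l} = {}"
        using disj kl empty by simp
      ultimately have "A {k} = {} \<or> A {l} = {}"
        by blast
      then show False
        using one kl by (metis card.empty zero_neq_one)
    qed
    ultimately obtain y where y: "y < m" "?Y = {..<m} - {y}"
      using card_eq_pred_iff[OF sub] m by auto
    moreover have "?Y \<inter> A {i} = {}"
      using meet[of "{..<n} - {i}" "{i}"] empty by simp
    moreover obtain x where "A {i} = {x}"
      using one[OF i] by (auto simp: card_1_singleton_iff)
    ultimately show ?thesis
      using sub[of "{i}"] by auto
  qed
  \<comment> \<open>An uncovered point would lie in every \<open>A ({..<n} - {i})\<close>, hence in
    their meet \<open>A {}\<close>; the induction forms this meet one factor at a time.\<close>
  have "(\<Union>i<n. A {i}) = {..<m}"
  proof (rule ccontr)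
    assume "(\<Union>i<n. A {i}) \<noteq> {..<m}"
    then obtain x where x: "x < m" "\<And>i. i < n \<Longrightarrow> x \<notin> A {i}"
      using sub by blast
    have in_A: "x \<in> A ({..<n} - {i})" if "i < n" for i
      using coatom[OF that] x that by auto
    have "k \<le> n \<Longrightarrow> x \<in> A ({..<n} - {..<k})" for k
    proof (induction k)
      case 0
      show ?case
        using in_A[of 0] mono[of "{..<n} - {0}" "{..<n}"] n by auto
    next
      case (Suc k)
      have "{..<n} - {..<Suc k} = ({..<n} - {..<k}) \<inter> ({..<n} - {k})"
        by auto
      then show ?case
        using Suc in_A[of k] by (simp add: meet)
    qed
    from this[of n] show False
      using empty by simp
  qed
  moreover have "card (\<Union>i<n. A {i}) = n"
    using disj empty fin one by (subst card_UN_disjoint) auto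
  ultimately show ?thesis
    by simp
qed

text \<open>The sets \<open>{0, 1}\<close>, \<open>{0, 2}\<close> and \<open>{0, 1, 2}\<close> are
  off the source weights, so their images have weight \<open>m - 1\<close> and coincide by
  monotonicity. Their meet \<open>A {0}\<close> has the same weight, although \<open>{0}\<close> is
  on a source weight.\<close>

lemma meet_pullback_not_complement:
  fixes A :: "nat set \<Rightarrow> nat set"
  assumes meet: "\<And>X Y. A (X \<inter> Y) = A X \<inter> A Y"
    and sub: "\<And>X. A X \<subseteq> {..<m}"
    and n: "5 \<le> n" and m: "5 \<le> m"
    and eq: "\<And>X. X \<subseteq> {..<n} \<Longrightarrow> card (A X) \<in> {1, m - 1} \<longleftrightarrow> card X \<notin> {1, n - 1}"
  shows False
proof -
  have mono: "A X \<subseteq> A Y" if "X \<subseteq> Y" for X Y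
    using meet[of X Y] that unfolding Int_absorb2[OF that] by blast
  have fin: "finite (A X)" for X
    using sub finite_subset by blast
  have "card (A {}) \<in> {1, m - 1}" and A0: "card (A {0}) \<notin> {1, m - 1}"
    using eq[of "{}"] eq[of "{0}"] n by auto
  moreover have "card (A {}) \<le> card (A {0})"
    by (intro card_mono fin mono) auto
  ultimately have ge2: "2 \<le> card (A {0})"
    using m by auto
  have big: "card (A X) = m - 1" if "X \<subseteq> {..<n}" "0 \<in> X" "card X \<notin> {1, n - 1}" for X
  proof -
    have "card (A {0}) \<le> card (A X)"
      using that by (intro card_mono fin mono) auto
    then show ?thesis
      using eq[OF that(1)] that(3) ge2 by auto
  qed
  have A01: "card (A {0, 1}) = m - 1" and "card (A {0, 2}) = m - 1" "card (A {0, 1, 2}) = m - 1"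
    using n by (intro big; simp)+
  then have "A {0, 1} = A {0, 1, 2}" "A {0, 2} = A {0, 1, 2}"
    by (intro card_subset_eq fin mono; auto)+
  moreover have "A {0} = A {0, 1} \<inter> A {0, 2}"
    using meet[of "{0, 1}" "{0, 2}"] by simp
  ultimately have "A {0} = A {0, 1}"
    by simp
  then show False
    using A0 A01 by simp
qed

section \<open>Relations of functions available for substitution\<close>

definition meet_rel :: "(nat set \<Rightarrow> bool) set" where
  "meet_rel = {r. \<forall>X Y. r (X \<inter> Y) = (r X \<and> r Y)}"

text \<open>The nested equality is the sum modulo 2 of three truth values. The ternary form admits
  affine maps with a constant term.\<close>

definition affine_rel :: "(nat set \<Rightarrow> bool) set" where
  "affine_rel = {r. \<forall>X Y Z. r (sym_diff X (sym_diff Y Z)) = (r X = (r Y = r Z))}"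

definition unary_rel :: "(nat set \<Rightarrow> bool) set" where
  "unary_rel = {r. \<exists>i d. r = (\<lambda>X. (i \<in> X) = d)} \<union> {r. \<exists>d. r = (\<lambda>X. d)}"

text \<open>The bound on \<open>i\<close> ensures that every member changes between
  \<open>{}\<close> and \<open>{..<n}\<close>.\<close>

definition literal_rel :: "nat \<Rightarrow> (nat set \<Rightarrow> bool) set" where
  "literal_rel n = {r. \<exists>i<n. \<exists>d. r = (\<lambda>X. (i \<in> X) = d)}"

definition variable_rel :: "(nat set \<Rightarrow> bool) set" where
  "variable_rel = insert (\<lambda>X. False) {r. \<exists>i. r = (\<lambda>X. i \<in> X)}"

lemma literal_rel_subset: "literal_rel n \<subseteq> unary_rel"
  by (auto simp: literal_rel_def unary_rel_def)

lemma literal_in_unary_rel: "(\<lambda>X. (i \<in> X) = d) \<in> unary_rel"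
  unfolding unary_rel_def by blast

lemma const_in_unary_rel: "(\<lambda>X. d) \<in> unary_rel"
  unfolding unary_rel_def by blast

lemma variable_in_unary_rel: "(\<lambda>X. i \<in> X) \<in> unary_rel"
  using literal_in_unary_rel[of i True] by simp

lemma variable_rel_subset: "variable_rel \<subseteq> unary_rel"
  unfolding variable_rel_def using const_in_unary_rel variable_in_unary_rel by blast

lemma tuple_map_meet:
  assumes "set rs \<subseteq> meet_rel"
  shows "tuple_map rs (X \<inter> Y) = tuple_map rs X \<inter> tuple_map rs Y"
proof -
  have "(rs ! j) (X \<inter> Y) = ((rs ! j) X \<and> (rs ! j) Y)" if "j < length rs" for j
    using assms nth_mem[OF that] by (auto simp: meet_rel_def)
  then show ?thesis
    by (auto simp: tuple_map_def)
qed

lemma tuple_map_affine: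
  assumes "set rs \<subseteq> affine_rel"
  shows "tuple_map rs (sym_diff X (sym_diff Y Z)) =
    sym_diff (tuple_map rs X) (sym_diff (tuple_map rs Y) (tuple_map rs Z))"
proof -
  have "(rs ! j) (sym_diff X (sym_diff Y Z)) = ((rs ! j) X = ((rs ! j) Y = (rs ! j) Z))"
    if "j < length rs" for j
    using assms nth_mem[OF that] unfolding affine_rel_def by blast
  then show ?thesis
    unfolding tuple_map_def by blast
qed

lemma unary_flip_unique:
  assumes "r \<in> unary_rel" "r {i} \<noteq> r {}" "r {k} \<noteq> r {}"
  shows "i = k"
  using assms by (auto simp: unary_rel_def)

lemma unary_flip_initial:
  assumes "r \<in> unary_rel"
  shows "r {..<n} \<noteq> r {} \<longleftrightarrow> (\<exists>i<n. r {i} \<noteq> r {})"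
  using assms by (auto simp: unary_rel_def)

section \<open>Tuples of essentially unary functions\<close>

context
  fixes rs :: "(nat set \<Rightarrow> bool) list" and m n :: nat
  assumes rs: "length rs = m" "set rs \<subseteq> unary_rel"
    and point: "\<And>i. i < n \<Longrightarrow> card (tuple_map rs {i}) \<in> {1, m}"
begin

abbreviation flips :: "nat \<Rightarrow> nat set" where
  "flips i \<equiv> sym_diff (tuple_map rs {}) (tuple_map rs {i})"

lemma flips_disjoint:
  assumes "i \<noteq> k"
  shows "flips i \<inter> flips k = {}"
proof -
  have "i = k" if "j \<in> flips i" "j \<in> flips k" for j
  proof (rule unary_flip_unique)
    show "rs ! j \<in> unary_rel"
      using that(1) rs by (auto simp: tuple_map_def)
    show "(rs ! j) {i} \<noteq> (rs ! j) {}" "(rs ! j) {k} \<noteq> (rs ! j) {}"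
      using that by (auto simp: tuple_map_def)
  qed
  then show ?thesis
    using assms by blast
qed

lemma flips_point:
  assumes "i < n"
  shows "card (sym_diff (tuple_map rs {}) (flips i)) \<in> {1, m}"
proof -
  have "sym_diff (tuple_map rs {}) (flips i) = tuple_map rs {i}"
    by blast
  then show ?thesis
    using point[OF assms] by simp
qed

text \<open>Each entry depends on at most one coordinate, so switching on the first \<open>n\<close>
  coordinates together changes exactly the entries changed by some single switch.\<close>

lemma Union_flips: "(\<Union>i<n. flips i) = sym_diff (tuple_map rs {}) (tuple_map rs {..<n})"
proof -
  have "j \<in> (\<Union>i<n. flips i) \<longleftrightarrow> j \<in> sym_diff (tuple_map rs {}) (tuple_map rs {..<n})" for j
  proof (cases "j < length rs")
    case True
    then have "rs ! j \<in> unary_rel"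
      using rs by auto
    from unary_flip_initial[OF this, of n] show ?thesis
      using True by (auto simp: tuple_map_def)
  qed (simp add: tuple_map_def)
  then show ?thesis
    by blast
qed

lemma unary_tuple_eq:
  assumes top: "card (tuple_map rs {..<n}) \<in> {1, m}"
    and bot: "card (tuple_map rs {}) \<notin> {1, m}" and n: "5 \<le> n"
  shows "m = n"
proof (rule disjoint_flips[where T = flips])
  show "tuple_map rs {} \<subseteq> {..<m}"
    using tuple_map_subset rs(1) by blast
  show "flips i \<subseteq> {..<m}" for i
    using tuple_map_subset rs(1) by blast
  have "sym_diff (tuple_map rs {}) (\<Union>i<n. flips i) = tuple_map rs {..<n}"
    unfolding Union_flips by blast
  then show "card (sym_diff (tuple_map rs {}) (\<Union>i<n. flips i)) \<in> {1, m}"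
    using top by simp
qed (use bot n flips_point flips_disjoint in auto)

text \<open>Every literal over the first \<open>n\<close> coordinates is flipped by one of them, so
  the flips cover \<open>{..<m}\<close> and \<open>disjoint_flips_covering\<close> applies.\<close>

lemma literal_tuple_bot:
  assumes lit: "set rs \<subseteq> literal_rel n" and m: "5 \<le> m"
  shows "card (tuple_map rs {}) \<notin> {1, m}"
proof
  assume bot: "card (tuple_map rs {}) \<in> {1, m}"
  show False
  proof (rule disjoint_flips_covering[where T = flips])
    show "tuple_map rs {} \<subseteq> {..<m}"
      using tuple_map_subset rs(1) by blast
    have "j \<in> sym_diff (tuple_map rs {}) (tuple_map rs {..<n})" if "j < m" for j
    proof -
      have "rs ! j \<in> literal_rel n"
        using lit rs that by auto
      then show ?thesis
        using that rs(1) by (auto simp: literal_rel_def tuple_map_def)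
    qed
    then show "(\<Union>i<n. flips i) = {..<m}"
      unfolding Union_flips using tuple_map_subset rs(1) by blast
  qed (use bot m flips_point flips_disjoint in auto)
qed

end

section \<open>The cases of the theorem\<close>

lemma Omega_1_subset_Pol_neq_rel:
  assumes "5 \<le> n" "0 \<notin> W n" "1 \<in> W n"
  shows "Omega_1 \<subseteq> Pol (neq_rel W n) (neq_rel W n)"
proof (rule Omega_1_subset_Pol)
  fix s assume s: "s \<in> neq_rel W n"
  show "(\<lambda>X. \<not> s X) \<in> neq_rel W n"
    unfolding neq_rel_def mem_Collect_eq
  proof
    assume "\<exists>c. \<forall>X\<subseteq>{..<n}. (\<not> s X) = ((card X \<in> W n) = c)"
    then obtain c where "\<forall>X\<subseteq>{..<n}. (\<not> s X) = ((card X \<in> W n) = c)"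
      by blast
    then have "\<forall>X\<subseteq>{..<n}. s X = ((card X \<in> W n) = (\<not> c))"
      by blast
    then show False
      using s unfolding neq_rel_def by blast
  qed
next
  fix d
  \<comment> \<open>The symmetric function differs at \<open>{}\<close> and \<open>{0}\<close>, so
    neither it nor its negation is constant.\<close>
  have "{0} \<subseteq> {..<n}" "card {0::nat} \<in> W n" "card ({} :: nat set) \<notin> W n"
    using assms by auto
  then show "(\<lambda>X. d) \<in> neq_rel W n"
    unfolding neq_rel_def mem_Collect_eq by (metis empty_subsetI)
qed

lemma const_in_horn_rel:
  assumes "5 \<le> n" "1 \<in> W n"
  shows "(\<lambda>X. d) \<in> horn_rel W n"
proof -
  have "{0} \<subseteq> {..<n}" "card {0::nat} \<in> W n"
    using assms by auto
  then show ?thesis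
    unfolding horn_rel_def by blast
qed

lemma signed_rel_False: "signed_rel False R = {r. (\<lambda>i. \<not> r i) \<in> R}"
  by (simp add: signed_rel_def)

text \<open>By De Morgan, complementation turns closure under conjunction into closure under
  disjunction.\<close>

lemma V_clone_subset_Pol_signed_False:
  assumes "\<And>r s. r \<in> R \<Longrightarrow> s \<in> R \<Longrightarrow> (\<lambda>i. r i \<and> s i) \<in> R" "\<And>c. (\<lambda>i. c) \<in> R"
  shows "V_clone \<subseteq> Pol (signed_rel False R) (signed_rel False R)"
  using assms by (intro V_clone_subset_Pol) (simp_all add: signed_rel_False)

lemma W_inf_subset_Pol_signed_False:
  assumes down: "\<And>s t. s \<in> S \<Longrightarrow> (\<And>i. t i \<Longrightarrow> s i) \<Longrightarrow> t \<in> S"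
  shows "W_inf \<subseteq> Pol (signed_rel False S) (signed_rel False S)"
proof (rule W_inf_subset_Pol)
  fix s t :: "'a \<Rightarrow> bool"
  assume "s \<in> signed_rel False S" "\<And>i. s i \<Longrightarrow> t i"
  then show "t \<in> signed_rel False S"
    unfolding signed_rel_False mem_Collect_eq by (rule_tac down[of "\<lambda>i. \<not> s i"]) auto
qed

lemma horn_rel_meet:
  "r \<in> horn_rel W n \<Longrightarrow> s \<in> horn_rel W n \<Longrightarrow> (\<lambda>X. r X \<and> s X) \<in> horn_rel W n"
  unfolding horn_rel_def by blast

lemma zero_rel_down: "s \<in> zero_rel W n \<Longrightarrow> (\<And>X. t X \<Longrightarrow> s X) \<Longrightarrow> t \<in> zero_rel W n"
  unfolding zero_rel_def by blast

lemma notin_zero_relD: "s \<notin> zero_rel W n \<Longrightarrow> X \<subseteq> {..<n} \<Longrightarrow> card X \<in> W n \<Longrightarrow> s X"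
  unfolding zero_rel_def by blast

lemma meet_rel_meet: "r \<in> meet_rel \<Longrightarrow> s \<in> meet_rel \<Longrightarrow> (\<lambda>X. r X \<and> s X) \<in> meet_rel"
  unfolding meet_rel_def by blast

lemma const_in_meet_rel: "(\<lambda>X. c) \<in> meet_rel"
  by (simp add: meet_rel_def)

abbreviation W_top :: "nat \<Rightarrow> nat set" where
  "W_top n \<equiv> {1, n}"

abbreviation W_coatom :: "nat \<Rightarrow> nat set" where
  "W_coatom n \<equiv> {1, n - 1}"

lemma sym_fun_notin_neq_rel: "(\<lambda>X. card (X \<inter> {..<n}) \<in> W n) \<notin> neq_rel W n"
proof -
  have "\<forall>X\<subseteq>{..<n}. (card (X \<inter> {..<n}) \<in> W n) = ((card X \<in> W n) = True)"
    by (simp add: Int_absorb2)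
  then show ?thesis
    unfolding neq_rel_def by blast
qed

lemma sym_fun_notin_horn_rel: "0 \<notin> W n \<Longrightarrow> (\<lambda>X. card (X \<inter> {..<n}) \<in> W n) \<notin> horn_rel W n"
  by (simp add: horn_rel_def Int_absorb2)

lemma sym_fun_notin_zero_rel: "(\<lambda>X. card (X \<inter> {..<n}) \<in> W n) \<notin> zero_rel W n"
  by (auto simp: zero_rel_def Int_absorb2)

lemma uncountable_affine:
  assumes "C1 \<subseteq> Pol affine_rel affine_rel" "C2 \<subseteq> Omega_1"
  shows "uncountable {K. clonoid C1 C2 K}"
proof (rule uncountable_clonoids_symmetric[where b = True and c = True and R = "\<lambda>n. affine_rel"
      and S = "neq_rel W_top" and W = W_top])
  show "C1 \<subseteq> Pol (signed_rel True affine_rel) (signed_rel True affine_rel)"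
    using assms by simp
  show "C2 \<subseteq> Pol (signed_rel True (neq_rel W_top n)) (signed_rel True (neq_rel W_top n))"
    if "5 \<le> n" for n
    using assms Omega_1_subset_Pol_neq_rel[of n W_top] that by auto
  show "(\<lambda>X. i \<in> X) \<in> affine_rel" for i
    by (auto simp: affine_rel_def)
  show "(\<lambda>X. card (X \<inter> {..<n}) \<in> W_top n) \<notin> neq_rel W_top n" for n
    by (rule sym_fun_notin_neq_rel)
  show "(\<lambda>X. card (tuple_map rs X) \<in> W_top m) \<in> neq_rel W_top n"
    if "odd m" "odd n" "5 \<le> m" "5 \<le> n" "m \<noteq> n" "length rs = m" "set rs \<subseteq> affine_rel" for m n rs
    unfolding neq_rel_def mem_Collect_eq
  proof
    assume "\<exists>c. \<forall>X\<subseteq>{..<n}. (card (tuple_map rs X) \<in> W_top m) = ((card X \<in> W_top n) = c)"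
    then obtain c where c: "\<forall>X\<subseteq>{..<n}. (card (tuple_map rs X) \<in> W_top m) = ((card X \<in> W_top n) = c)"
      by blast
    have "m = n"
    proof (rule affine_pullback_circuit[where A = "tuple_map rs" and m = m and n = n and c = c])
      show "tuple_map rs (sym_diff X (sym_diff Y Z)) =
          sym_diff (tuple_map rs X) (sym_diff (tuple_map rs Y) (tuple_map rs Z))" for X Y Z
        using that(7) by (rule tuple_map_affine)
      show "tuple_map rs X \<subseteq> {..<m}" for X
        using tuple_map_subset[of rs X] that(6) by simp
      show "(card (tuple_map rs X) \<in> {1, m}) = ((card X \<in> {1, n}) = c)" if "X \<subseteq> {..<n}" for X
        using c that by blast
    qed (fact that)+
    then show False
      using that(5) by simp
  qed
qed

lemma uncountable_unary:
  assumes "C1 \<subseteq> Omega_1"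
    and "\<And>n. 5 \<le> n \<Longrightarrow> C2 \<subseteq> Pol (signed_rel c (horn_rel W_top n)) (signed_rel c (horn_rel W_top n))"
  shows "uncountable {K. clonoid C1 C2 K}"
proof (rule uncountable_clonoids_symmetric[where b = True and c = c and R = "\<lambda>n. unary_rel"
      and S = "horn_rel W_top" and W = W_top])
  have "Omega_1 \<subseteq> Pol unary_rel unary_rel"
  proof (rule Omega_1_subset_Pol)
    fix r assume "r \<in> unary_rel"
    then consider i d where "r = (\<lambda>X. (i \<in> X) = d)" | d where "r = (\<lambda>X. d)"
      unfolding unary_rel_def by blast
    then show "(\<lambda>X. \<not> r X) \<in> unary_rel"
    proof cases
      case 1
      then show ?thesis
        using literal_in_unary_rel[of i "\<not> d"] by simp
    next
      case 2
      then show ?thesis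
        by (simp add: const_in_unary_rel)
    qed
  qed (rule const_in_unary_rel)
  then show "C1 \<subseteq> Pol (signed_rel True unary_rel) (signed_rel True unary_rel)"
    using assms by simp
  show "(\<lambda>X. i \<in> X) \<in> unary_rel" for i
    by (rule variable_in_unary_rel)
  show "(\<lambda>X. card (X \<inter> {..<n}) \<in> W_top n) \<notin> horn_rel W_top n" if "5 \<le> n" for n
    using that by (intro sym_fun_notin_horn_rel) simp
  show "(\<lambda>X. card (tuple_map rs X) \<in> W_top m) \<in> horn_rel W_top n"
    if "odd m" "odd n" "5 \<le> m" "5 \<le> n" "m \<noteq> n" "length rs = m" "set rs \<subseteq> unary_rel" for m n rs
    unfolding horn_rel_def mem_Collect_eq
  proof (intro impI, rule ccontr)
    assume *: "\<forall>X\<subseteq>{..<n}. card X \<in> W_top n \<longrightarrow> card (tuple_map rs X) \<in> W_top m"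
      and bot: "card (tuple_map rs {}) \<notin> W_top m"
    have "card (tuple_map rs {i}) \<in> W_top m" if "i < n" for i
      using * that by simp
    moreover have "card (tuple_map rs {..<n}) \<in> W_top m"
      using * by simp
    ultimately have "m = n"
      using bot by (intro unary_tuple_eq[OF that(6,7)] that(4))
    then show False
      using that(5) by simp
  qed
qed (use assms in auto)

lemma uncountable_literal:
  assumes "C1 \<subseteq> I_star"
    and "\<And>n. C2 \<subseteq> Pol (signed_rel c (zero_rel W_top n)) (signed_rel c (zero_rel W_top n))"
  shows "uncountable {K. clonoid C1 C2 K}"
proof (rule uncountable_clonoids_symmetric[where b = True and c = c and R = literal_rel
      and S = "zero_rel W_top" and W = W_top])
  have "I_star \<subseteq> Pol (literal_rel n) (literal_rel n)" for n
  proof (rule I_star_subset_Pol)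
    fix r assume "r \<in> literal_rel n"
    then obtain i d where "i < n" "r = (\<lambda>X. (i \<in> X) = d)"
      unfolding literal_rel_def by blast
    then have "i < n" "(\<lambda>X. \<not> r X) = (\<lambda>X. (i \<in> X) = (\<not> d))"
      by auto
    then show "(\<lambda>X. \<not> r X) \<in> literal_rel n"
      unfolding literal_rel_def by blast
  qed
  then show "C1 \<subseteq> Pol (signed_rel True (literal_rel n)) (signed_rel True (literal_rel n))" for n
    using assms by auto
  show "(\<lambda>X. i \<in> X) \<in> literal_rel n" if "i < n" for i n
  proof -
    have "(\<lambda>X. i \<in> X) = (\<lambda>X. (i \<in> X) = True)"
      by simp
    then show ?thesis
      unfolding literal_rel_def using that by blast
  qed
  show "(\<lambda>X. card (X \<inter> {..<n}) \<in> W_top n) \<notin> zero_rel W_top n" for n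
    by (rule sym_fun_notin_zero_rel)
  show "(\<lambda>X. card (tuple_map rs X) \<in> W_top m) \<in> zero_rel W_top n"
    if "odd m" "odd n" "5 \<le> m" "5 \<le> n" "m \<noteq> n" "length rs = m" "set rs \<subseteq> literal_rel n" for m n rs
  proof (rule ccontr)
    assume *: "\<not> ?thesis"
    have un: "set rs \<subseteq> unary_rel"
      using that literal_rel_subset by blast
    have pt: "card (tuple_map rs {i}) \<in> W_top m" if "i < n" for i
      by (rule notin_zero_relD[OF *]) (use that in auto)
    have "m = n"
    proof (rule unary_tuple_eq[OF that(6) un pt])
      show "card (tuple_map rs {..<n}) \<in> W_top m"
        by (rule notin_zero_relD[OF *]) auto
      show "card (tuple_map rs {}) \<notin> W_top m"
        by (rule literal_tuple_bot[OF that(6) un pt that(7,3)])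
    qed (use that(4) in simp_all)
    then show False
      using that(5) by simp
  qed
qed (use assms in auto)

lemma uncountable_variable:
  assumes "C1 \<subseteq> Pol (signed_rel b variable_rel) (signed_rel b variable_rel)"
    and "\<And>n. C2 \<subseteq> Pol (signed_rel c (zero_rel W_top n)) (signed_rel c (zero_rel W_top n))"
  shows "uncountable {K. clonoid C1 C2 K}"
proof (rule uncountable_clonoids_symmetric[where b = b and c = c and R = "\<lambda>n. variable_rel"
      and S = "zero_rel W_top" and W = W_top])
  show "(\<lambda>X. i \<in> X) \<in> variable_rel" for i
    by (auto simp: variable_rel_def)
  show "(\<lambda>X. card (X \<inter> {..<n}) \<in> W_top n) \<notin> zero_rel W_top n" for n
    by (rule sym_fun_notin_zero_rel)
  show "(\<lambda>X. card (tuple_map rs X) \<in> W_top m) \<in> zero_rel W_top n"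
    if "odd m" "odd n" "5 \<le> m" "5 \<le> n" "m \<noteq> n" "length rs = m" "set rs \<subseteq> variable_rel" for m n rs
  proof (rule ccontr)
    assume *: "\<not> ?thesis"
    have un: "set rs \<subseteq> unary_rel"
      using that variable_rel_subset by blast
    have pt: "card (tuple_map rs {i}) \<in> W_top m" if "i < n" for i
      by (rule notin_zero_relD[OF *]) (use that in auto)
    have top: "card (tuple_map rs {..<n}) \<in> W_top m"
      by (rule notin_zero_relD[OF *]) auto
    \<comment> \<open>Variables and the constant 0 all vanish at the zero point, so the tuple there
      has weight 0.\<close>
    have "\<not> (rs ! j) {}" if "j < length rs" for j
      using \<open>set rs \<subseteq> variable_rel\<close> nth_mem[OF that] by (auto simp: variable_rel_def)
    then have "tuple_map rs {} = {}"
      by (auto simp: tuple_map_def)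
    then have bot: "card (tuple_map rs {}) \<notin> W_top m"
      using that(3) by simp
    have "m = n"
      by (rule unary_tuple_eq[OF that(6) un pt top bot that(4)])
    then show False
      using that(5) by simp
  qed
qed (use assms in auto)

lemma uncountable_meet_horn:
  assumes "C1 \<subseteq> Pol (signed_rel b meet_rel) (signed_rel b meet_rel)"
    and "\<And>n. 5 \<le> n \<Longrightarrow> C2 \<subseteq> Pol (signed_rel c (horn_rel W_coatom n)) (signed_rel c (horn_rel W_coatom n))"
  shows "uncountable {K. clonoid C1 C2 K}"
proof (rule uncountable_clonoids_symmetric[where b = b and c = c and R = "\<lambda>n. meet_rel"
      and S = "horn_rel W_coatom" and W = W_coatom])
  show "(\<lambda>X. i \<in> X) \<in> meet_rel" for i
    by (auto simp: meet_rel_def)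
  show "(\<lambda>X. card (X \<inter> {..<n}) \<in> W_coatom n) \<notin> horn_rel W_coatom n" if "5 \<le> n" for n
    using that by (intro sym_fun_notin_horn_rel) simp
  show "(\<lambda>X. card (tuple_map rs X) \<in> W_coatom m) \<in> horn_rel W_coatom n"
    if "odd m" "odd n" "5 \<le> m" "5 \<le> n" "m \<noteq> n" "length rs = m" "set rs \<subseteq> meet_rel" for m n rs
    unfolding horn_rel_def mem_Collect_eq
  proof (intro impI, rule ccontr)
    assume *: "\<forall>X\<subseteq>{..<n}. card X \<in> W_coatom n \<longrightarrow> card (tuple_map rs X) \<in> W_coatom m"
      and bot: "card (tuple_map rs {}) \<notin> W_coatom m"
    have "m = n"
    proof (rule meet_pullback_implies_eq[OF tuple_map_meet[OF that(7)] _ that(4,3) _ bot])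
      show "tuple_map rs X \<subseteq> {..<m}" for X
        using tuple_map_subset[of rs X] that(6) by simp
      show "card (tuple_map rs X) \<in> W_coatom m" if "X \<subseteq> {..<n}" "card X \<in> W_coatom n" for X
        using * that by blast
    qed
    then show False
      using that(5) by simp
  qed
qed (use assms in auto)

lemma uncountable_meet_neq:
  assumes "C1 \<subseteq> Pol (signed_rel b meet_rel) (signed_rel b meet_rel)" "C2 \<subseteq> Omega_1"
  shows "uncountable {K. clonoid C1 C2 K}"
proof (rule uncountable_clonoids_symmetric[where b = b and c = True and R = "\<lambda>n. meet_rel"
      and S = "neq_rel W_coatom" and W = W_coatom])
  show "C2 \<subseteq> Pol (signed_rel True (neq_rel W_coatom n)) (signed_rel True (neq_rel W_coatom n))"
    if "5 \<le> n" for n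
    using assms Omega_1_subset_Pol_neq_rel[of n W_coatom] that by auto
  show "(\<lambda>X. i \<in> X) \<in> meet_rel" for i
    by (auto simp: meet_rel_def)
  show "(\<lambda>X. card (X \<inter> {..<n}) \<in> W_coatom n) \<notin> neq_rel W_coatom n" for n
    by (rule sym_fun_notin_neq_rel)
  show "(\<lambda>X. card (tuple_map rs X) \<in> W_coatom m) \<in> neq_rel W_coatom n"
    if "odd m" "odd n" "5 \<le> m" "5 \<le> n" "m \<noteq> n" "length rs = m" "set rs \<subseteq> meet_rel" for m n rs
    unfolding neq_rel_def mem_Collect_eq
  proof
    assume "\<exists>c. \<forall>X\<subseteq>{..<n}. (card (tuple_map rs X) \<in> W_coatom m) = ((card X \<in> W_coatom n) = c)"
    then obtain c where c: "(card (tuple_map rs X) \<in> W_coatom m) = ((card X \<in> W_coatom n) = c)"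
      if "X \<subseteq> {..<n}" for X
      by blast
    have meet: "tuple_map rs (X \<inter> Y) = tuple_map rs X \<inter> tuple_map rs Y" for X Y
      using that(7) by (rule tuple_map_meet)
    have sub: "tuple_map rs X \<subseteq> {..<m}" for X
      using tuple_map_subset[of rs X] that(6) by simp
    show False
    \<comment> \<open>The pullback is either the symmetric function itself, which forces
      \<open>m = n\<close>, or its negation, which is impossible.\<close>
    proof (cases c)
      case True
      have "card (tuple_map rs {}) \<notin> W_coatom m"
        using c[of "{}"] True that(4) by simp
      then have "m = n"
        using c True by (intro meet_pullback_implies_eq[OF meet sub that(4,3)]) blast+
      then show False
        using that(5) by simp
    next
      case False
      then show False
        using c by (intro meet_pullback_not_complement[OF meet sub that(4,3)]) blast
    qed
  qed
qed (use assms in auto)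

section \<open>Invariance of the relations up to duality\<close>

lemma meet_rel_invariant:
  assumes "C \<subseteq> Lambda_clone \<or> C \<subseteq> V_clone"
  shows "\<exists>b. C \<subseteq> Pol (signed_rel b meet_rel) (signed_rel b meet_rel)"
  using assms
proof
  assume "C \<subseteq> Lambda_clone"
  also have "\<dots> \<subseteq> Pol meet_rel meet_rel"
    by (intro Lambda_clone_subset_Pol meet_rel_meet const_in_meet_rel)
  finally show ?thesis
    by (intro exI[of _ True]) simp
next
  assume "C \<subseteq> V_clone"
  also have "\<dots> \<subseteq> Pol (signed_rel False meet_rel) (signed_rel False meet_rel)"
    by (intro V_clone_subset_Pol_signed_False meet_rel_meet const_in_meet_rel)
  finally show ?thesis ..
qed

lemma horn_rel_invariant:
  assumes "C \<subseteq> Lambda_clone \<or> C \<subseteq> V_clone" and W: "\<And>n. 1 \<in> W n"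
  shows "\<exists>c. \<forall>n\<ge>5. C \<subseteq> Pol (signed_rel c (horn_rel W n)) (signed_rel c (horn_rel W n))"
  using assms(1)
proof
  assume C: "C \<subseteq> Lambda_clone"
  have "Lambda_clone \<subseteq> Pol (horn_rel W n) (horn_rel W n)" if "5 \<le> n" for n
    using that W by (intro Lambda_clone_subset_Pol horn_rel_meet const_in_horn_rel)
  then show ?thesis
    using order_trans[OF C] by (intro exI[of _ True]) simp
next
  assume C: "C \<subseteq> V_clone"
  have "V_clone \<subseteq> Pol (signed_rel False (horn_rel W n)) (signed_rel False (horn_rel W n))"
    if "5 \<le> n" for n
    using that W by (intro V_clone_subset_Pol_signed_False horn_rel_meet const_in_horn_rel)
  then show ?thesis
    using order_trans[OF C] by (intro exI[of _ False]) simp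
qed

lemma zero_rel_invariant:
  assumes "C \<subseteq> U_inf \<or> C \<subseteq> W_inf"
  shows "\<exists>c. \<forall>n. C \<subseteq> Pol (signed_rel c (zero_rel W n)) (signed_rel c (zero_rel W n))"
  using assms
proof
  assume C: "C \<subseteq> U_inf"
  have "U_inf \<subseteq> Pol (zero_rel W n) (zero_rel W n)" for n
    by (rule U_inf_subset_Pol) (rule zero_rel_down)
  then show ?thesis
    using order_trans[OF C] by (intro exI[of _ True]) simp
next
  assume C: "C \<subseteq> W_inf"
  have "W_inf \<subseteq> Pol (signed_rel False (zero_rel W n)) (signed_rel False (zero_rel W n))" for n
    by (rule W_inf_subset_Pol_signed_False) (rule zero_rel_down)
  then show ?thesis
    using order_trans[OF C] by (intro exI[of _ False]) simp
qed

lemma variable_rel_invariant: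
  assumes "C \<subseteq> I_0 \<or> C \<subseteq> I_1"
  shows "\<exists>b. C \<subseteq> Pol (signed_rel b variable_rel) (signed_rel b variable_rel)"
  using assms
proof
  assume "C \<subseteq> I_0"
  also have "\<dots> \<subseteq> Pol variable_rel variable_rel"
    by (rule I_0_subset_Pol) (simp add: variable_rel_def)
  finally show ?thesis
    by (intro exI[of _ True]) simp
next
  assume "C \<subseteq> I_1"
  also have "\<dots> \<subseteq> Pol (signed_rel False variable_rel) (signed_rel False variable_rel)"
    by (rule I_1_subset_Pol) (simp add: signed_rel_False variable_rel_def)
  finally show ?thesis ..
qed

lemma affine_rel_invariant:
  assumes "C \<subseteq> Omega_1 \<or> C \<subseteq> L_clone"
  shows "C \<subseteq> Pol affine_rel affine_rel"
proof -
  have "Omega_1 \<subseteq> Pol affine_rel affine_rel"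
    by (rule Omega_1_subset_Pol) (auto simp: affine_rel_def)
  moreover have "L_clone \<subseteq> Pol affine_rel affine_rel"
    by (rule L_clone_subset_Pol) (auto simp: affine_rel_def)
  ultimately show ?thesis
    using assms by (meson order_trans)
qed

section \<open>The six groups of clone pairs\<close>

lemma uncountable_linear_source:
  assumes "C1 \<subseteq> Omega_1 \<or> C1 \<subseteq> L_clone" "C2 \<subseteq> Omega_1"
  shows "uncountable {K. clonoid C1 C2 K}"
  using affine_rel_invariant[OF assms(1)] assms(2) by (rule uncountable_affine)

lemma uncountable_unary_semilattice:
  assumes "C1 \<subseteq> Omega_1" "C2 \<subseteq> Lambda_clone \<or> C2 \<subseteq> V_clone"
  shows "uncountable {K. clonoid C1 C2 K}"
proof -
  have "\<exists>c. \<forall>n\<ge>5. C2 \<subseteq> Pol (signed_rel c (horn_rel W_top n)) (signed_rel c (horn_rel W_top n))"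
    using assms(2) by (rule horn_rel_invariant) simp
  then obtain c where
    "\<forall>n\<ge>5. C2 \<subseteq> Pol (signed_rel c (horn_rel W_top n)) (signed_rel c (horn_rel W_top n))" ..
  then show ?thesis
    using assms(1) by (intro uncountable_unary[of C1 C2 c]) simp_all
qed

lemma uncountable_literal_separating:
  assumes "C1 \<subseteq> I_star" "C2 \<subseteq> U_inf \<or> C2 \<subseteq> W_inf"
  shows "uncountable {K. clonoid C1 C2 K}"
proof -
  obtain c where "\<forall>n. C2 \<subseteq> Pol (signed_rel c (zero_rel W_top n)) (signed_rel c (zero_rel W_top n))"
    using zero_rel_invariant[OF assms(2)] ..
  then show ?thesis
    using assms(1) by (intro uncountable_literal[of C1 C2 c]) simp_all
qed

lemma uncountable_variable_separating:
  assumes "C1 \<subseteq> I_0 \<or> C1 \<subseteq> I_1" "C2 \<subseteq> U_inf \<or> C2 \<subseteq> W_inf"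
  shows "uncountable {K. clonoid C1 C2 K}"
proof -
  obtain b where b: "C1 \<subseteq> Pol (signed_rel b variable_rel) (signed_rel b variable_rel)"
    using variable_rel_invariant[OF assms(1)] ..
  obtain c where "\<forall>n. C2 \<subseteq> Pol (signed_rel c (zero_rel W_top n)) (signed_rel c (zero_rel W_top n))"
    using zero_rel_invariant[OF assms(2)] ..
  then show ?thesis
    using b by (intro uncountable_variable[of C1 b C2 c]) simp_all
qed

lemma uncountable_semilattice_semilattice:
  assumes "C1 \<subseteq> Lambda_clone \<or> C1 \<subseteq> V_clone" "C2 \<subseteq> Lambda_clone \<or> C2 \<subseteq> V_clone"
  shows "uncountable {K. clonoid C1 C2 K}"
proof -
  obtain b where b: "C1 \<subseteq> Pol (signed_rel b meet_rel) (signed_rel b meet_rel)"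
    using meet_rel_invariant[OF assms(1)] ..
  have "\<exists>c. \<forall>n\<ge>5. C2 \<subseteq> Pol (signed_rel c (horn_rel W_coatom n)) (signed_rel c (horn_rel W_coatom n))"
    using assms(2) by (rule horn_rel_invariant) simp
  then obtain c where
    "\<forall>n\<ge>5. C2 \<subseteq> Pol (signed_rel c (horn_rel W_coatom n)) (signed_rel c (horn_rel W_coatom n))" ..
  then show ?thesis
    using b by (intro uncountable_meet_horn[of C1 b C2 c]) simp_all
qed

lemma uncountable_semilattice_unary:
  assumes "C1 \<subseteq> Lambda_clone \<or> C1 \<subseteq> V_clone" "C2 \<subseteq> Omega_1"
  shows "uncountable {K. clonoid C1 C2 K}"
proof -
  obtain b where "C1 \<subseteq> Pol (signed_rel b meet_rel) (signed_rel b meet_rel)"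
    using meet_rel_invariant[OF assms(1)] ..
  then show ?thesis
    using assms(2) by (rule uncountable_meet_neq)
qed

theorem theorem4p1:
  fixes C1 C2 K1 K2 :: "boolfun set"
  assumes "clone C1" and "clone C2"
    and "(K1, K2) \<in>
      {(Omega_1, Omega_1), (Omega_1, Lambda_clone), (Omega_1, V_clone),
       (I_star, U_inf), (I_star, W_inf),
       (I_0, U_inf), (I_1, U_inf), (I_0, W_inf), (I_1, W_inf),
       (L_clone, Omega_1),
       (Lambda_clone, Lambda_clone), (Lambda_clone, V_clone),
       (V_clone, Lambda_clone), (V_clone, V_clone),
       (Lambda_clone, Omega_1), (V_clone, Omega_1)}"
    and "C1 \<subseteq> K1" and "C2 \<subseteq> K2"
  shows "uncountable {K. clonoid C1 C2 K}"
  \<comment> \<open>Each of the sixteen pairs falls into one of the six groups.\<close>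
  using assms(3-5)
  by (auto simp: uncountable_linear_source uncountable_unary_semilattice
      uncountable_literal_separating uncountable_variable_separating
      uncountable_semilattice_semilattice uncountable_semilattice_unary)

end
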